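(* Let $X$ be a Hilbert space with scalar product $\langle\cdot,\cdot\rangle$, let $U$ be a Banach space, let $A:D(A)\to X$ generate a $C_0$-semigroup on $X$, let $B\in L(U,X)$, and let $C:X\times U\to X$ be a map for which there exist $K>0$ and $\xi\in\mathcal{K}$ such that $\|C(x,u)\|_X\le K\|x\|_X\,\xi(\|u\|_U)$ for all $x\in X$, $u\in U$. Assume that $f(x,u):=Bu+C(x,u)$ is Lipschitz continuous on bounded subsets of $X$, uniformly with respect to the second argument, and that $f(x,\cdot)$ is continuous for every $x\in X$. Assume that there exists a coercive positive self-adjoint operator $P\in L(X)$ satisfying $$\langle Ax,Px\rangle+\langle Px,Ax\rangle=-\|x\|_X^2\qquad\text{for all }x\in D(A).$$ Consider the system $\dot x(t)=Ax(t)+Bu(t)+C(x(t),u(t))$, $x(0)=\phi_0$, and let $$W(x)=\ln\bigl(1+\langle Px,x\rangle\bigr).$$ (1) If $A$ generates an analytic semigroup, then the system is iISS and $W$ is an iISS Lyapunov function for it. (2) If $A$ does not necessarily generate an analytic semigroup, but all trajectories emanating from $D(A)$ under arbitrary inputs $u\in U_c$ remain in $D(A)$, then the system is still iISS and $W$ is an iISS Lyapunov function for it on $D(A)$.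
   Context: $\mathbb{R}_+=[0,\infty)$; $L(U,X)$ is the space of bounded linear operators from $U$ to $X$, $L(X)=L(X,X)$. Admissible inputs are $u\in U_c=C_b(\mathbb{R}_+,U)$, the bounded continuous functions $\mathbb{R}_+\to U$ with the supremum norm. Solutions are mild solutions: continuous $x$ with $x(t)=T(t)x(0)+\int_0^tT(t-s)f(x(s),u(s))\,ds$, where $\{T(t)\}_{t\ge0}$ is the $C_0$-semigroup generated by $A$. $\phi(t,\phi_0,u)$ denotes the state at time $t$ of the solution with initial condition $\phi_0\in X$ at $t=0$ and input $u$. $f:X\times U\to X$ is Lipschitz continuous on bounded subsets of $X$, uniformly w.r.t. the second argument, if for every $w>0$ there is $L(w)>0$ such that $\|f(y,v)-f(x,v)\|_X\le L(w)\|y-x\|_X$ for all $x,y$ with $\|x\|_X\le w$, $\|y\|_X\le w$ and all $v\in U$. A self-adjoint $P\in L(X)$ is positive if $\langle Px,x\rangle>0$ for all $x\in X\setminus\{0\}$; a positive $P\in L(X)$ is coercive if there is $k>0$ with $\langle Px,x\rangle\ge k\|x\|_X^2$ for all $x$. Comparison functions: $\mathcal{P}$ = continuous $\gamma:\mathbb{R}_+\to\mathbb{R}_+$ with $\gamma(0)=0$ and $\gamma(r)>0$ for $r>0$; $\mathcal{K}$ = strictly increasing functions in $\mathcal{P}$; $\mathcal{K}_\infty$ = unbounded functions in $\mathcal{K}$; $\mathcal{L}$ = continuous strictly decreasing $\gamma:\mathbb{R}_+\to\mathbb{R}_+$ with $\lim_{t\to\infty}\gamma(t)=0$; $\mathcal{KL}$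 = continuous $\beta:\mathbb{R}_+\times\mathbb{R}_+\to\mathbb{R}_+$ with $\beta(\cdot,t)\in\mathcal{K}$ for all $t\ge0$ and $\beta(r,\cdot)\in\mathcal{L}$ for all $r>0$. iISS: there are $\theta\in\mathcal{K}_\infty$, $\mu\in\mathcal{K}$, $\beta\in\mathcal{KL}$ such that $\|\phi(t,\phi_0,u)\|_X\le\beta(\|\phi_0\|_X,t)+\theta\left(\int_0^t\mu(\|u(s)\|_U)\,ds\right)$ for all $\phi_0\in X$, $u\in U_c$, $t\ge0$ (in particular solutions exist for all $t\ge 0$). iISS Lyapunov function: a continuous $V:X\to\mathbb{R}_+$ for which there exist $\psi_1,\psi_2\in\mathcal{K}_\infty$, $\alpha\in\mathcal{P}$, $\sigma\in\mathcal{K}$ such that $\psi_1(\|x\|_X)\le V(x)\le\psi_2(\|x\|_X)$ for all $x\in X$ and $\dot V_u(x)\le-\alpha(\|x\|_X)+\sigma(\|u(0)\|_U)$ for all $x\in X$ and $u\in U_c$, where $\dot V_u(x)=\limsup_{t\to+0}\frac1t\bigl(V(\phi(t,x,u))-V(x)\bigr)$. "iISS Lyapunov function on $D(A)$" means an iISS Lyapunov function for the system restricted to the state space $D(A)$ (endowed with the norm $\|\cdot\|_X$) and inputs $U_c$, i.e. the inequalities $\psi_1(\|x\|_X)\le V(x)\le\psi_2(\|x\|_X)$ and $\dot V_u(x)\le-\alpha(\|x\|_X)+\sigma(\|u(0)\|_U)$ are required for $x\in D(A)$ and $u\in U_c$. *)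

theory Defs
  imports "HOL-Analysis.Analysis"
begin

section \<open>Hilbert and Banach spaces over the real or the complex numbers\<close>

text \<open>
  Up to isomorphism the only instances are the real and the complex numbers: the range of
  \<open>to_complex\<close> is a real subspace of the plane that contains the real line.
\<close>

class real_or_complex = real_normed_field +
  fixes to_complex :: "'a \<Rightarrow> complex"
  assumes to_complex_add: "to_complex (a + b) = to_complex a + to_complex b"
    and to_complex_mult: "to_complex (a * b) = to_complex a * to_complex b"
    and to_complex_scaleR: "to_complex (r *\<^sub>R a) = r *\<^sub>R to_complex a"
    and norm_to_complex: "norm (to_complex a) = norm a"

instantiation real :: real_or_complex
begin
definition to_complex_real :: "real \<Rightarrow> complex" where "to_complex_real = complex_of_real"
instance by standard (simp_all add: to_complex_real_def scaleR_conv_of_real)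
end

instantiation complex :: real_or_complex
begin
definition to_complex_complex :: "complex \<Rightarrow> complex" where "to_complex_complex = id"
instance by standard (simp_all add: to_complex_complex_def)
end

definition re_part :: "'k::real_or_complex \<Rightarrow> real" where
  "re_part a = Re (to_complex a)"

locale banach_over =
  vector_space scale for scale :: "'k::real_or_complex \<Rightarrow> 'x::banach \<Rightarrow> 'x" +
  assumes scale_of_real: "scale (of_real r) x = r *\<^sub>R x"
    and norm_scale: "norm (scale c x) = norm c * norm x"

text \<open>
  The class \<open>real_inner\<close> supplies the norm and the underlying real Hilbert space; \<open>ip\<close> is
  the scalar product with values in the scalar field (linear in its first argument). Its real
  part is the library's \<open>inner\<close>, see \<open>re_part_ip\<close>; over the real numbers it is
  \<open>inner\<close> itself, see \<open>hilbert_over_real_iff\<close>.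
\<close>

locale hilbert_over =
  banach_over scale for scale :: "'k::real_or_complex \<Rightarrow> 'x::{real_inner, banach} \<Rightarrow> 'x" +
  fixes ip :: "'x \<Rightarrow> 'x \<Rightarrow> 'k"
  assumes ip_add_left: "ip (x + y) z = ip x z + ip y z"
    and ip_scale_left: "ip (scale c x) y = c * ip x y"
    and ip_hermitian: "to_complex (ip y x) = cnj (to_complex (ip x y))"
    and ip_self: "ip x x = of_real ((norm x)\<^sup>2)"

lemma to_complex_1: "to_complex (1::'k::real_or_complex) = 1"
proof -
  have "to_complex (1::'k) * to_complex (1::'k) = to_complex (1::'k)"
    by (simp flip: to_complex_mult)
  moreover have "to_complex (1::'k) \<noteq> 0"
    by (metis norm_to_complex norm_one norm_zero zero_neq_one)
  ultimately show ?thesis by simp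
qed

lemma to_complex_of_real: "to_complex (of_real r :: 'k::real_or_complex) = of_real r"
  by (simp add: of_real_def to_complex_scaleR to_complex_1)

lemma (in hilbert_over) re_part_ip: "re_part (ip x y) = inner x y"
proof -
  have "to_complex (ip (x + y) (x + y)) = of_real ((norm (x + y))\<^sup>2)"
    by (simp only: ip_self to_complex_of_real)
  then have "Re (to_complex (ip (x + y) (x + y))) = inner (x + y) (x + y)"
    by (simp add: power2_norm_eq_inner del: inner_simps)
  moreover have "Re (to_complex (ip z z)) = inner z z" for z
    by (simp only: ip_self to_complex_of_real power2_norm_eq_inner Re_complex_of_real)
  moreover have "Re (to_complex (ip a (b + c))) = Re (to_complex (ip a b)) + Re (to_complex (ip a c))" for a b c
    by (metis ip_hermitian ip_add_left to_complex_add complex_cnj_add plus_complex.sel(1))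
  moreover have "Re (to_complex (ip y x)) = Re (to_complex (ip x y))"
    by (simp add: ip_hermitian[of y x])
  ultimately show ?thesis
    by (simp add: re_part_def ip_add_left to_complex_add inner_simps inner_commute)
qed

lemma hilbert_over_real_iff:
  fixes scale :: "real \<Rightarrow> 'x::{real_inner, banach} \<Rightarrow> 'x"
  shows "hilbert_over scale ip \<longleftrightarrow> scale = (*\<^sub>R) \<and> ip = inner"
proof
  assume h: "hilbert_over scale ip"
  then interpret hilbert_over scale ip .
  show "scale = (*\<^sub>R) \<and> ip = inner"
    using scale_of_real re_part_ip by (simp add: fun_eq_iff re_part_def to_complex_real_def)
next
  assume "scale = (*\<^sub>R) \<and> ip = inner"
  then show "hilbert_over scale ip"
    by unfold_locales
      (simp_all add: scaleR_add_right scaleR_add_left inner_simps inner_commute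
        power2_norm_eq_inner to_complex_real_def)
qed


section \<open>Bounded operators\<close>

definition bounded_op ::
  "('k \<Rightarrow> 'x::real_normed_vector \<Rightarrow> 'x) \<Rightarrow> ('k \<Rightarrow> 'y::real_normed_vector \<Rightarrow> 'y) \<Rightarrow> ('x \<Rightarrow> 'y) \<Rightarrow> bool"
  where "bounded_op sc1 sc2 F \<longleftrightarrow>
    bounded_linear F \<and> (\<forall>c x. F (sc1 c x) = sc2 c (F x))"

definition self_adjoint_op :: "('x \<Rightarrow> 'x \<Rightarrow> 'k) \<Rightarrow> ('x \<Rightarrow> 'x) \<Rightarrow> bool" where
  "self_adjoint_op ip P \<longleftrightarrow> (\<forall>x y. ip (P x) y = ip x (P y))"

text \<open>For self-adjoint \<open>P\<close> the scalar \<open>ip (P x) x\<close> is real, so it equals its \<open>re_part\<close>.\<close>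

definition positive_op :: "('x::real_normed_vector \<Rightarrow> 'x \<Rightarrow> 'k::real_or_complex) \<Rightarrow> ('x \<Rightarrow> 'x) \<Rightarrow> bool" where
  "positive_op ip P \<longleftrightarrow> self_adjoint_op ip P \<and> (\<forall>x. x \<noteq> 0 \<longrightarrow> re_part (ip (P x) x) > 0)"

definition coercive_op :: "('x::real_normed_vector \<Rightarrow> 'x \<Rightarrow> 'k::real_or_complex) \<Rightarrow> ('x \<Rightarrow> 'x) \<Rightarrow> bool" where
  "coercive_op ip P \<longleftrightarrow> positive_op ip P \<and> (\<exists>k>0. \<forall>x. re_part (ip (P x) x) \<ge> k * (norm x)\<^sup>2)"


section \<open>Semigroups and generators\<close>

text \<open>Only the values \<open>T t\<close> with \<open>t \<ge> 0\<close> are relevant.\<close>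

definition C0_semigroup :: "('k \<Rightarrow> 'x::real_normed_vector \<Rightarrow> 'x) \<Rightarrow> (real \<Rightarrow> 'x \<Rightarrow> 'x) \<Rightarrow> bool" where
  "C0_semigroup sc T \<longleftrightarrow>
     (\<forall>t\<ge>0. bounded_op sc sc (T t)) \<and>
     (\<forall>x. T 0 x = x) \<and>
     (\<forall>s\<ge>0. \<forall>t\<ge>0. \<forall>x. T (s + t) x = T s (T t x)) \<and>
     (\<forall>x. ((\<lambda>t. T t x) \<longlongrightarrow> x) (at_right 0))"

text \<open>The operator \<open>A\<close> with domain \<open>D\<close> is the generator of \<open>T\<close>; \<open>A\<close> is irrelevant outside \<open>D\<close>.\<close>

definition generates ::
  "('k \<Rightarrow> 'x::real_normed_vector \<Rightarrow> 'x) \<Rightarrow> 'x set \<Rightarrow> ('x \<Rightarrow> 'x) \<Rightarrow> (real \<Rightarrow> 'x \<Rightarrow> 'x) \<Rightarrow> bool" where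
  "generates sc D A T \<longleftrightarrow>
     C0_semigroup sc T \<and>
     D = {x. \<exists>y. ((\<lambda>h. (1 / h) *\<^sub>R (T h x - x)) \<longlongrightarrow> y) (at_right 0)} \<and>
     (\<forall>x\<in>D. ((\<lambda>h. (1 / h) *\<^sub>R (T h x - x)) \<longlongrightarrow> A x) (at_right 0))"

definition sector :: "real \<Rightarrow> complex set" where
  "sector \<delta> = {z. z \<noteq> 0 \<and> \<bar>Arg z\<bar> < \<delta>}"

text \<open>
  Analyticity on a complex space with scalar multiplication \<open>sc\<close>: \<open>T\<close> extends to a
  semigroup on an open sector around the positive half-line, holomorphic there with respect
  to the operator norm and strongly continuous at the origin on every smaller sector.
\<close>

definition complex_analytic_semigroup ::
  "(complex \<Rightarrow> 'x::real_normed_vector \<Rightarrow> 'x) \<Rightarrow> (real \<Rightarrow> 'x \<Rightarrow> 'x) \<Rightarrow> bool" where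
  "complex_analytic_semigroup sc T \<longleftrightarrow>
     (\<exists>\<delta> S. 0 < \<delta> \<and> \<delta> \<le> pi / 2 \<and>
        (\<forall>t\<ge>0. S (complex_of_real t) = T t) \<and>
        (\<forall>x. S 0 x = x) \<and>
        (\<forall>z\<in>sector \<delta>. bounded_op sc sc (S z)) \<and>
        (\<forall>z\<in>sector \<delta>. \<forall>w\<in>sector \<delta>. \<forall>x. S (z + w) x = S z (S w x)) \<and>
        (\<forall>z\<in>sector \<delta>. \<exists>S'. bounded_op sc sc S' \<and>
           ((\<lambda>w. onorm (\<lambda>x. sc (1 / (w - z)) (S w x - S z x) - S' x)) \<longlongrightarrow> 0) (at z)) \<and>
        (\<forall>\<delta>'. 0 < \<delta>' \<and> \<delta>' < \<delta> \<longrightarrow> (\<forall>x. ((\<lambda>z. S z x) \<longlongrightarrow> x) (at 0 within sector \<delta>'))))"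

text \<open>
  The complexification of a real space consists of the pairs \<open>(x, y)\<close>, read as \<open>x + i y\<close>.
\<close>

definition complexified_scale :: "complex \<Rightarrow> 'x \<times> 'x \<Rightarrow> 'x \<times> 'x::real_vector" where
  "complexified_scale c p =
     (Re c *\<^sub>R fst p - Im c *\<^sub>R snd p, Im c *\<^sub>R fst p + Re c *\<^sub>R snd p)"

lemma banach_over_complexified_scale:
  "banach_over (complexified_scale :: complex \<Rightarrow> 'x \<times> 'x \<Rightarrow> 'x \<times> 'x::{real_inner, banach})"
proof unfold_locales
  fix c :: complex and p :: "'x \<times> 'x"
  have "(norm (complexified_scale c p))\<^sup>2 = (norm c * norm p)\<^sup>2"
    unfolding power2_norm_eq_inner power_mult_distrib cmod_power2
    by (simp add: complexified_scale_def inner_prod_def inner_complex_def inner_simps inner_commute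
        power2_eq_square algebra_simps)
  then show "norm (complexified_scale c p) = norm c * norm p"
    by (simp add: power2_eq_iff_nonneg)
qed (auto simp: complexified_scale_def prod_eq_iff algebra_simps)

text \<open>
  The map \<open>to_complex\<close> is surjective exactly if the scalar field is the complex field. Over
  the real field a semigroup is analytic if its complexification is.
\<close>

definition analytic_semigroup ::
  "('k::real_or_complex \<Rightarrow> 'x::real_normed_vector \<Rightarrow> 'x) \<Rightarrow> (real \<Rightarrow> 'x \<Rightarrow> 'x) \<Rightarrow> bool" where
  "analytic_semigroup sc T \<longleftrightarrow>
     (if surj (to_complex :: 'k \<Rightarrow> complex)
      then complex_analytic_semigroup (\<lambda>z. sc (inv to_complex z)) T
      else complex_analytic_semigroup complexified_scale (\<lambda>t p. (T t (fst p), T t (snd p))))"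


section \<open>Mild solutions\<close>

definition admissible_inputs :: "(real \<Rightarrow> 'u::real_normed_vector) set" where
  "admissible_inputs = {u. continuous_on {0..} u \<and> bounded (u ` {0..})}"

text \<open>Here \<open>I\<close> is meant to be an interval with left end point 0 that contains 0.\<close>

definition mild_solution ::
  "(real \<Rightarrow> 'x \<Rightarrow> 'x) \<Rightarrow> ('x \<Rightarrow> 'u \<Rightarrow> 'x) \<Rightarrow> (real \<Rightarrow> 'u) \<Rightarrow> real set \<Rightarrow> (real \<Rightarrow> 'x::banach) \<Rightarrow> bool" where
  "mild_solution T f u I x \<longleftrightarrow>
     continuous_on I x \<and>
     (\<forall>t\<in>I. (\<lambda>s. T (t - s) (f (x s) (u s))) integrable_on {0..t} \<and>
            x t = T t (x 0) + integral {0..t} (\<lambda>s. T (t - s) (f (x s) (u s))))"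

definition phi ::
  "(real \<Rightarrow> 'x \<Rightarrow> 'x) \<Rightarrow> ('x \<Rightarrow> 'u \<Rightarrow> 'x) \<Rightarrow> real \<Rightarrow> 'x \<Rightarrow> (real \<Rightarrow> 'u) \<Rightarrow> 'x::banach" where
  "phi T f t x0 u = (THE y. \<exists>x. mild_solution T f u {0..t} x \<and> x 0 = x0 \<and> x t = y)"

definition lipschitz_on_bounded_sets ::
  "('x::real_normed_vector \<Rightarrow> 'u \<Rightarrow> 'x) \<Rightarrow> bool" where
  "lipschitz_on_bounded_sets f \<longleftrightarrow>
     (\<forall>w>0. \<exists>L>0. \<forall>x y v. norm x \<le> w \<longrightarrow> norm y \<le> w \<longrightarrow>
        norm (f y v - f x v) \<le> L * norm (y - x))"


section \<open>Comparison functions\<close>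

text \<open>Functions on the nonnegative half-line; values at negative arguments are irrelevant.\<close>

definition class_P :: "(real \<Rightarrow> real) set" where
  "class_P = {\<gamma>. continuous_on {0..} \<gamma> \<and> \<gamma> 0 = 0 \<and> (\<forall>r>0. \<gamma> r > 0)}"

definition class_K :: "(real \<Rightarrow> real) set" where
  "class_K = {\<gamma>. \<gamma> \<in> class_P \<and> strict_mono_on {0..} \<gamma>}"

definition class_K_inf :: "(real \<Rightarrow> real) set" where
  "class_K_inf = {\<gamma>. \<gamma> \<in> class_K \<and> (\<forall>M. \<exists>r\<ge>0. \<gamma> r > M)}"

definition class_L :: "(real \<Rightarrow> real) set" where
  "class_L = {\<gamma>. continuous_on {0..} \<gamma> \<and> (\<forall>t\<ge>0. \<gamma> t \<ge> 0) \<and>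
     (\<forall>s\<ge>0. \<forall>t>s. \<gamma> t < \<gamma> s) \<and> (\<gamma> \<longlongrightarrow> 0) at_top}"

definition class_KL :: "(real \<Rightarrow> real \<Rightarrow> real) set" where
  "class_KL = {\<beta>. continuous_on ({0..} \<times> {0..}) (\<lambda>(r, t). \<beta> r t) \<and>
     (\<forall>t\<ge>0. (\<lambda>r. \<beta> r t) \<in> class_K) \<and> (\<forall>r>0. \<beta> r \<in> class_L)}"


section \<open>Integral input-to-state stability\<close>

text \<open>
  The first conjunct says that \<open>phi\<close> really is the global mild solution with the given
  initial value, so that the estimate concerns well-defined trajectories.
\<close>

definition iISS :: "(real \<Rightarrow> 'x \<Rightarrow> 'x) \<Rightarrow> ('x \<Rightarrow> 'u::banach \<Rightarrow> 'x::banach) \<Rightarrow> bool" where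
  "iISS T f \<longleftrightarrow>
     (\<forall>x0. \<forall>u\<in>admissible_inputs.
        mild_solution T f u {0..} (\<lambda>t. phi T f t x0 u) \<and> phi T f 0 x0 u = x0) \<and>
     (\<exists>\<theta>\<in>class_K_inf. \<exists>\<mu>\<in>class_K. \<exists>\<beta>\<in>class_KL.
        \<forall>x0. \<forall>u\<in>admissible_inputs. \<forall>t\<ge>0.
          norm (phi T f t x0 u) \<le>
            \<beta> (norm x0) t + \<theta> (integral {0..t} (\<lambda>s. \<mu> (norm (u s)))))"

definition lie_derivative ::
  "(real \<Rightarrow> 'x \<Rightarrow> 'x) \<Rightarrow> ('x \<Rightarrow> 'u \<Rightarrow> 'x::banach) \<Rightarrow> ('x \<Rightarrow> real) \<Rightarrow> (real \<Rightarrow> 'u) \<Rightarrow> 'x \<Rightarrow> ereal" where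
  "lie_derivative T f V u x =
     Limsup (at_right 0) (\<lambda>t. ereal ((V (phi T f t x u) - V x) / t))"

text \<open>\<open>S\<close> is the state space, with the norm of the ambient space.\<close>

definition iISS_lyapunov_on ::
  "'x set \<Rightarrow> (real \<Rightarrow> 'x \<Rightarrow> 'x) \<Rightarrow> ('x \<Rightarrow> 'u::banach \<Rightarrow> 'x::banach) \<Rightarrow> ('x \<Rightarrow> real) \<Rightarrow> bool" where
  "iISS_lyapunov_on S T f V \<longleftrightarrow>
     continuous_on S V \<and> (\<forall>x\<in>S. V x \<ge> 0) \<and>
     (\<exists>\<psi>1\<in>class_K_inf. \<exists>\<psi>2\<in>class_K_inf. \<exists>\<alpha>\<in>class_P. \<exists>\<sigma>\<in>class_K.
        (\<forall>x\<in>S. \<psi>1 (norm x) \<le> V x \<and> V x \<le> \<psi>2 (norm x)) \<and>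
        (\<forall>x\<in>S. \<forall>u\<in>admissible_inputs.
           lie_derivative T f V u x \<le> ereal (- \<alpha> (norm x) + \<sigma> (norm (u 0)))))"

end

theory Submission
  imports Defs
begin

text \<open>
  For \<open>x\<close> in the domain the Lyapunov
  equation makes the right derivative of \<open>V (T t x)\<close>, where \<open>V x = \<langle>Px, x\<rangle>\<close>, equal to
  \<open>- (norm (T t x))\<^sup>2\<close>; the integrated form of this identity involves bounded operators only
  and extends to all \<open>x\<close> by density. By the variation of constants formula, \<open>V\<close> therefore has,
  along every mild solution, the right derivative \<open>2 \<langle>Px, f(x, u)\<rangle> - (norm x)\<^sup>2\<close>.
  With \<open>c = 1 / (2p)\<close>, where \<open>p\<close> bounds the norm of \<open>P\<close>, the growth condition on
  \<open>f\<close> turns this into \<open>V' \<le> - c V + (1 + V) \<sigma>(norm u)\<close>, which gives both the dissipation inequality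
  for \<open>W = ln (1 + V)\<close> and, with \<open>S\<close> the integral of \<open>\<sigma>(norm u)\<close>, the estimate
  \<open>1 + V(t) \<le> exp (S t) (1 + V(0) exp (- c t))\<close>.
\<close>

section \<open>Real analysis and comparison functions\<close>

text \<open>A mild solution need be neither differentiable nor contained in \<open>D\<close>, so the
  Lyapunov equation cannot be inserted along it. What exists is the right derivative of
  \<open>V\<close> along it, and this dictates the tools: monotonicity has to follow from one-sided
  derivatives of continuous functions. The rate \<open>1 / (2 * p)\<close> arises because half of
  the decay \<open>(norm x)\<^sup>2\<close> is spent on the cross term with \<open>B u\<close>, and
  the other half is compared with \<open>V\<close> through \<open>p\<close>. The contribution of
  \<open>C\<close> has the size of \<open>V\<close> times a function of the input, which no decay
  rate of \<open>V\<close> can absorb; the logarithm divides by \<open>1 + V\<close> and turns it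
  into a pure input gain. The growth bound also decides global existence: the estimate is proved for
  every forcing term that obeys it, hence for a truncated, globally Lipschitz equation before the
  original one is known to have global solutions.\<close>

lemma uniform_boundedness:
  fixes F :: "'i \<Rightarrow> 'a::banach \<Rightarrow> 'b::real_normed_vector"
  assumes lin: "\<And>i. i \<in> I \<Longrightarrow> bounded_linear (F i)"
    and ptw: "\<And>x. \<exists>c. \<forall>i\<in>I. norm (F i x) \<le> c"
  shows "\<exists>M>0. \<forall>i\<in>I. \<forall>x. norm (F i x) \<le> M * norm x"
proof -
  define E where "E n = {x. \<forall>i\<in>I. norm (F i x) \<le> real n}" for n :: nat
  have cl: "closed (E n)" for n
  proof -
    have "E n = (\<Inter>i\<in>I. {x. norm (F i x) \<le> real n})"
      by (auto simp: E_def)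
    moreover have "closed {x. norm (F i x) \<le> real n}" if "i \<in> I" for i
      using lin[OF that] by (intro closed_Collect_le continuous_intros)
        (auto intro!: continuous_intros linear_continuous_on)
    ultimately show ?thesis by auto
  qed
  have "\<Union>(range E) = UNIV"
  proof (intro equalityI subsetI UNIV_I)
    fix x
    obtain c where "\<forall>i\<in>I. norm (F i x) \<le> c"
      using ptw by blast
    moreover obtain n where "c \<le> real n"
      using real_arch_simple by blast
    ultimately show "x \<in> \<Union>(range E)"
      by (auto simp: E_def intro: order_trans)
  qed
  then have "\<exists>n. interior (E n) \<noteq> {}"
    using Met_TC.metric_Baire_category_alt[of "range E"] cl
    by (fastforce simp: complete_UNIV)
  then obtain n x0 r where r: "r > 0" "cball x0 r \<subseteq> E n"
    by (metis ex_in_conv mem_interior_cball)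
  \<comment> \<open>Baire's theorem has put a ball into one \<open>E n\<close>. As
    \<open>F i y\<close> is the difference of the values at \<open>x0 + y\<close> and
    \<open>x0\<close>, its norm is at most \<open>2 * n\<close> when \<open>norm y = r\<close>. The
    summand 1 keeps the constant positive for \<open>n = 0\<close>.\<close>
  have "norm (F i x) \<le> (2 * real n / r + 1) * norm x" if i: "i \<in> I" for i x
  proof (cases "x = 0")
    case True
    then show ?thesis using linear_0[OF bounded_linear.linear[OF lin[OF i]]] by simp
  next
    case False
    interpret bounded_linear "F i" by (rule lin[OF i])
    define y where "y = (r / norm x) *\<^sub>R x"
    have "norm y = r" using False r by (simp add: y_def)
    then have "x0 + y \<in> E n" "x0 \<in> E n"
      using r by (auto simp: subset_iff dist_norm)
    then have "norm (F i (x0 + y)) \<le> n" "norm (F i x0) \<le> n"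
      using i by (auto simp: E_def)
    then have "norm (F i y) \<le> 2 * real n"
      using norm_triangle_ineq4[of "F i (x0 + y)" "F i x0"] by (simp add: add)
    then have "norm (F i x) \<le> 2 * real n / r * norm x"
      using False r by (simp add: y_def scaleR field_simps)
    then show ?thesis by (simp add: distrib_right add_increasing2)
  qed
  moreover have "2 * real n / r + 1 > 0" using r by (simp add: add_nonneg_pos)
  ultimately show ?thesis by blast
qed

section \<open>One-sided derivatives and integrals\<close>

lemma real_derivative_at_right_iff:
  fixes f :: "real \<Rightarrow> real"
  shows "(f has_real_derivative d) (at_right t) \<longleftrightarrow>
    ((\<lambda>h. (f (t + h) - f t) / h) \<longlongrightarrow> d) (at_right 0)"
  by (simp add: has_field_derivative_iff filterlim_at_right_to_0[where a = t] add.commute[of _ t])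

text \<open>With right derivatives alone, a supremum argument replaces the mean value theorem: at
  the last time \<open>c\<close> at which \<open>f\<close> is not above the line of slope
  \<open>e' > 0\<close> through its initial value, the right derivative is smaller than
  \<open>e'\<close>, so \<open>f\<close> stays below the line a little longer.\<close>

lemma right_derivative_nonpos_imp_le:
  fixes f :: "real \<Rightarrow> real"
  assumes "a \<le> b" and cont: "continuous_on {a..b} f"
    and der: "\<And>t. a \<le> t \<Longrightarrow> t < b \<Longrightarrow> \<exists>d\<le>0. (f has_real_derivative d) (at_right t)"
  shows "f b \<le> f a"
proof (rule field_le_epsilon)
  fix e :: real assume "e > 0"
  \<comment> \<open>The summand 1 keeps the denominator positive when \<open>a = b\<close>; the line
    rises by at most \<open>e\<close> over the whole interval.\<close>
  define e' where "e' = e / (b - a + 1)"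
  have e': "e' > 0" using \<open>e > 0\<close> \<open>a \<le> b\<close> by (simp add: e'_def)
  have "f b \<le> f a + e' * (b - a)"
  proof (rule ccontr)
    assume neg: "\<not> f b \<le> f a + e' * (b - a)"
    define S where "S = {t\<in>{a..b}. f t \<le> f a + e' * (t - a)}"
    have "compact S"
    proof -
      have "closed S" unfolding S_def
        by (intro continuous_on_closed_Collect_le continuous_intros cont)
      moreover have "bounded S" by (rule bounded_subset[of "{a..b}"]) (auto simp: S_def)
      ultimately show ?thesis by (simp add: compact_eq_bounded_closed)
    qed
    moreover have "a \<in> S" using \<open>a \<le> b\<close> by (simp add: S_def)
    ultimately obtain c where c: "c \<in> S" "\<And>t. t \<in> S \<Longrightarrow> t \<le> c"
      using compact_attains_sup[of S] by blast
    then have "a \<le> c" "c < b" using neg by (auto simp: S_def order_less_le)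
    from der[OF this] obtain d where d: "d \<le> 0" "(f has_real_derivative d) (at_right c)"
      by blast
    then have "((\<lambda>t. (f t - f c) / (t - c)) \<longlongrightarrow> d) (at_right c)"
      by (simp add: has_field_derivative_iff)
    then have "eventually (\<lambda>t. (f t - f c) / (t - c) < e') (at_right c)"
      by (rule order_tendstoD(2)) (use d e' in linarith)
    moreover have "eventually (\<lambda>t. t \<in> {c<..<b}) (at_right c)"
      using \<open>c < b\<close> by (rule eventually_at_right_real)
    ultimately have "eventually (\<lambda>t. False) (at_right c)"
    proof eventually_elim
      case (elim t)
      then have t: "c < t" "t < b" by auto
      have "f t - f c < e' * (t - c)"
        using elim(1) t(1) by (simp only: pos_divide_less_eq diff_gt_0_iff_gt)
      moreover have "f c \<le> f a + e' * (c - a)" using c(1) by (simp add: S_def)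
      moreover have "e' * (t - a) = e' * (t - c) + e' * (c - a)"
        by (simp flip: distrib_left)
      ultimately have "f t \<le> f a + e' * (t - a)" by linarith
      then have "t \<in> S" using t \<open>a \<le> c\<close> by (simp add: S_def)
      from c(2)[OF this] t show False by simp
    qed
    then show False by simp
  qed
  also have "\<dots> \<le> f a + e"
  proof -
    have "e' * (b - a) \<le> e' * (b - a + 1)" using e' by (intro mult_left_mono) auto
    moreover have "e' * (b - a + 1) = e" using \<open>a \<le> b\<close> by (simp add: e'_def)
    ultimately show ?thesis by simp
  qed
  finally show "f b \<le> f a + e" .
qed

lemma right_derivative_zero_imp_eq:
  fixes f :: "real \<Rightarrow> real"
  assumes "a \<le> b" and cont: "continuous_on {a..b} f"
    and der: "\<And>t. a \<le> t \<Longrightarrow> t < b \<Longrightarrow> (f has_real_derivative 0) (at_right t)"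
  shows "f b = f a"
proof (rule antisym)
  show "f b \<le> f a"
    by (rule right_derivative_nonpos_imp_le[OF assms(1) cont]) (use der in blast)
  have "\<exists>d\<le>0. ((\<lambda>t. - f t) has_real_derivative d) (at_right t)" if "a \<le> t" "t < b" for t
    using DERIV_minus[OF der[OF that]] by (intro exI[of _ 0]) simp
  then have "- f b \<le> - f a"
    using assms(1) cont by (intro right_derivative_nonpos_imp_le[of a b "\<lambda>t. - f t"] continuous_on_minus)
  then show "f a \<le> f b" by simp
qed

lemma integral_right_derivative:
  fixes w :: "real \<Rightarrow> real"
  assumes w: "continuous_on {a..} w" and "a \<le> t"
  shows "((\<lambda>t. integral {a..t} w) has_real_derivative w t) (at_right t)"
proof -
  have "((\<lambda>t. integral {a..t} w) has_real_derivative w t) (at t within {a..t + 1})"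
    using \<open>a \<le> t\<close> by (intro integral_has_real_derivative continuous_on_subset[OF w]) auto
  then have "((\<lambda>t. integral {a..t} w) has_real_derivative w t) (at t within {t..t + 1})"
    by (rule DERIV_subset) (use \<open>a \<le> t\<close> in auto)
  then show ?thesis by (simp add: at_within_Icc_at_right)
qed

text \<open>Moving \<open>h\<close> out of the domain of integration turns quotients by
  \<open>h\<close> into integrals over a fixed interval that depend continuously on a parameter,
  down to \<open>h = 0\<close>.\<close>

lemma integral_rescale:
  fixes g :: "real \<Rightarrow> 'a::banach"
  assumes "h \<ge> 0" and "continuous_on {t..t + h} g"
  shows "integral {t..t + h} g = h *\<^sub>R integral {0..1} (\<lambda>r. g (t + h * r))"
proof (cases "h = 0")
  case False
  then have "h > 0" using assms by simp
  have "(g has_integral integral {t..t + h} g) (cbox t (t + h))"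
    using assms by (simp add: integrable_continuous_real integrable_integral)
  from has_integral_affinity'[OF this \<open>h > 0\<close>, of t]
  have "((\<lambda>r. g (t + h * r)) has_integral (integral {t..t + h} g /\<^sub>R h)) {0..1}"
    using \<open>h > 0\<close> by (simp add: add.commute)
  then show ?thesis using \<open>h > 0\<close> by (simp add: integral_unique)
qed simp

section \<open>The radial retraction onto a ball\<close>

definition radial :: "real \<Rightarrow> 'a::real_normed_vector \<Rightarrow> 'a" where
  "radial R x = (R / max R (norm x)) *\<^sub>R x"

lemma radial_id: "R > 0 \<Longrightarrow> norm x \<le> R \<Longrightarrow> radial R x = x"
  by (simp add: radial_def max_def)

lemma norm_radial_le:
  assumes "R > 0"
  shows "norm (radial R x) \<le> R" "norm (radial R x) \<le> norm x"
proof -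
  have "R * norm x \<le> R * max R (norm x)" "R * norm x \<le> norm x * max R (norm x)"
    using assms by (auto intro: mult_left_mono simp: mult.commute[of R])
  then show "norm (radial R x) \<le> R" "norm (radial R x) \<le> norm x"
    using assms by (auto simp: radial_def field_simps max_def)
qed

text \<open>The difference splits into a scaled copy of \<open>x - y\<close> and a change of the
  scaling factor. The latter acts on \<open>y\<close>, whose norm is at most \<open>b\<close>, and
  the truncated norms \<open>a\<close> and \<open>b\<close> differ by at most
  \<open>norm (x - y)\<close>. Each part contributes 1 to the constant, in any normed space.\<close>

lemma radial_lipschitz:
  assumes R: "R > 0"
  shows "norm (radial R x - radial R y) \<le> 2 * norm (x - y)"
proof -
  define a b where "a = max R (norm x)" and "b = max R (norm y)"
  have ab: "a > 0" "b > 0" "R \<le> a" "norm y \<le> b" using R by (auto simp: a_def b_def)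
  have "radial R x - radial R y = (R / a) *\<^sub>R (x - y) + (R / a - R / b) *\<^sub>R y"
    by (simp add: radial_def a_def b_def algebra_simps)
  then have "norm (radial R x - radial R y) \<le> R / a * norm (x - y) + \<bar>R / a - R / b\<bar> * norm y"
    using norm_triangle_ineq[of "(R / a) *\<^sub>R (x - y)" "(R / a - R / b) *\<^sub>R y"] R ab by simp
  also have "\<bar>R / a - R / b\<bar> * norm y = R / a * (norm y / b) * \<bar>b - a\<bar>"
  proof -
    have "R / a - R / b = R / a * (1 / b) * (b - a)" using ab by (simp add: field_simps)
    then show ?thesis using R ab by (simp add: abs_mult)
  qed
  also have "\<dots> \<le> 1 * 1 * norm (x - y)"
  proof (intro mult_mono)
    have "\<bar>b - a\<bar> \<le> \<bar>norm x - norm y\<bar>" by (auto simp: a_def b_def max_def)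
    then show "\<bar>b - a\<bar> \<le> norm (x - y)" using norm_triangle_ineq3[of x y] by linarith
  qed (use R ab in auto)
  also have "R / a * norm (x - y) \<le> 1 * norm (x - y)"
    using R ab by (intro mult_right_mono) auto
  finally show ?thesis by simp
qed

lemma continuous_on_radial: "R > 0 \<Longrightarrow> continuous_on S (radial R)"
  unfolding radial_def by (intro continuous_intros) (auto simp: max_def)

lemma integral_exp_mult:
  fixes c :: real
  assumes "c > 0" "t \<ge> 0"
  shows "integral {0..t} (\<lambda>s. exp (c * s)) = (exp (c * t) - 1) / c"
proof -
  have "((\<lambda>s. exp (c * s)) has_integral (exp (c * t) / c - exp (c * 0) / c)) {0..t}"
    using assms by (intro fundamental_theorem_of_calculus)
      (auto intro!: derivative_eq_intros simp flip: has_real_derivative_iff_has_vector_derivative)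
  then show ?thesis by (simp add: integral_unique diff_divide_distrib)
qed

section \<open>The comparison functions of the final estimates\<close>

lemma class_K_inf_ln:
  assumes "a > 0"
  shows "(\<lambda>r. ln (1 + a * r\<^sup>2)) \<in> class_K_inf"
proof -
  have pos: "1 + a * r\<^sup>2 > 0" for r :: real
    using assms by (intro add_pos_nonneg) auto
  have "\<exists>r\<ge>0. m < ln (1 + a * r\<^sup>2)" for m
  proof (intro exI conjI)
    \<comment> \<open>Chosen so that \<open>a * r\<^sup>2 = exp m\<close>.\<close>
    show "sqrt (exp m / a) \<ge> 0" using assms by simp
    have "m = ln (exp m)" by simp
    also have "\<dots> < ln (1 + exp m)" by (subst ln_less_cancel_iff) (auto simp: add_pos_pos)
    finally show "m < ln (1 + a * (sqrt (exp m / a))\<^sup>2)" using assms by simp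
  qed
  moreover have "continuous_on {0..} (\<lambda>r. ln (1 + a * r\<^sup>2))"
    using pos by (intro continuous_intros) (auto simp: less_le)
  moreover have "strict_mono_on {0..} (\<lambda>r. ln (1 + a * r\<^sup>2))"
    using pos assms by (auto intro!: strict_mono_onI power_strict_mono)
  moreover have "0 < ln (1 + a * r\<^sup>2)" if "r > 0" for r
    using assms that by (intro ln_gt_zero) simp
  ultimately show ?thesis
    using assms by (auto simp: class_K_inf_def class_K_def class_P_def)
qed

text \<open>The decay rate of \<open>ln (1 + V)\<close>: differentiating the logarithm divides
  quadratic decay by a quadratic quantity. The result stays below \<open>1 / (2 * a)\<close>, so it
  is not of class K-infinity; such a rate is typical of iISS as opposed to ISS.\<close>

lemma class_P_rational:
  assumes "a > 0"
  shows "(\<lambda>r. r\<^sup>2 / (2 * (1 + a * r\<^sup>2))) \<in> class_P"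
proof -
  have pos: "1 + a * r\<^sup>2 > 0" for r :: real
    using assms by (intro add_pos_nonneg) auto
  have ne: "2 * (1 + a * r\<^sup>2) \<noteq> 0" for r :: real
    using pos[of r] by (metis mult_eq_0_iff less_irrefl zero_neq_numeral)
  have "continuous_on {0..} (\<lambda>r. r\<^sup>2 / (2 * (1 + a * r\<^sup>2)))"
    by (intro continuous_intros ballI ne)
  moreover have "r\<^sup>2 / (2 * (1 + a * r\<^sup>2)) > 0" if "r > 0" for r
    using pos[of r] that by (intro divide_pos_pos mult_pos_pos) auto
  ultimately show ?thesis unfolding class_P_def by simp
qed

lemma class_K_add_power2:
  assumes "c \<ge> 0" "d > 0" "\<xi> \<in> class_K"
  shows "(\<lambda>r. c * r\<^sup>2 + d * \<xi> r) \<in> class_K"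
proof -
  have \<xi>: "continuous_on {0..} \<xi>" "\<xi> 0 = 0" "\<And>r. r > 0 \<Longrightarrow> \<xi> r > 0" "strict_mono_on {0..} \<xi>"
    using assms(3) by (auto simp: class_K_def class_P_def)
  have "continuous_on {0..} (\<lambda>r. c * r\<^sup>2 + d * \<xi> r)"
    by (intro continuous_intros \<xi>)
  moreover have "c * r\<^sup>2 + d * \<xi> r > 0" if "r > 0" for r
    using assms \<xi>(3)[OF that] by (intro add_nonneg_pos) auto
  moreover have "strict_mono_on {0..} (\<lambda>r. c * r\<^sup>2 + d * \<xi> r)"
  proof (rule strict_mono_onI)
    fix r s :: real assume rs: "r \<in> {0..}" "s \<in> {0..}" "r < s"
    then have "\<xi> r < \<xi> s" using \<xi>(4) by (auto simp: strict_mono_on_def)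
    moreover have "c * r\<^sup>2 \<le> c * s\<^sup>2" using assms rs by (intro mult_left_mono power_mono) auto
    ultimately show "c * r\<^sup>2 + d * \<xi> r < c * s\<^sup>2 + d * \<xi> s"
      using assms by (intro add_le_less_mono) auto
  qed
  ultimately show ?thesis using \<xi>(2) by (auto simp: class_K_def class_P_def)
qed

lemma class_K_inf_sqrt_exp:
  assumes "k > 0"
  shows "(\<lambda>s. sqrt ((exp (2 * s) - 1) / k)) \<in> class_K_inf"
proof -
  have "\<exists>r\<ge>0. m < sqrt ((exp (2 * r) - 1) / k)" for m
  proof (intro exI conjI)
    \<comment> \<open>By \<open>exp s \<ge> 1 + s\<close> it suffices that \<open>2 * r / k\<close>
      exceeds the square of \<open>m\<close>.\<close>
    let ?r = "k * (m\<^sup>2 + 1) / 2"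
    show "?r \<ge> 0" using assms by auto
    have "m\<^sup>2 < m\<^sup>2 + 1" by simp
    also have "\<dots> = 2 * ?r / k" using assms by simp
    also have "\<dots> \<le> (exp (2 * ?r) - 1) / k"
    proof (rule divide_right_mono)
      show "2 * ?r \<le> exp (2 * ?r) - 1" using exp_ge_add_one_self[of "2 * ?r"] by linarith
    qed (use assms in simp)
    finally have "sqrt (m\<^sup>2) < sqrt ((exp (2 * ?r) - 1) / k)" by (rule real_sqrt_less_mono)
    then show "m < sqrt ((exp (2 * ?r) - 1) / k)" by simp
  qed
  moreover have "continuous_on {0..} (\<lambda>s. sqrt ((exp (2 * s) - 1) / k))"
    using assms by (intro continuous_intros) auto
  moreover have "strict_mono_on {0..} (\<lambda>s. sqrt ((exp (2 * s) - 1) / k))"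
    using assms by (auto intro!: strict_mono_onI divide_strict_right_mono)
  ultimately show ?thesis
    using assms by (auto simp: class_K_inf_def class_K_def class_P_def)
qed

text \<open>The arguments enter only through \<open>p * r\<^sup>2 * exp (- c * t)\<close>, in which
  the function is strictly increasing; growth in \<open>r\<close> and decay in \<open>t\<close> are
  both read off from this one quantity.\<close>

lemma class_KL_decay:
  assumes "k > 0" "p > 0" "c > 0"
  shows "(\<lambda>r t. sqrt (((1 + p * r\<^sup>2 * exp (- c * t))\<^sup>2 - 1) / k)) \<in> class_KL"
proof -
  let ?\<beta> = "\<lambda>r t. sqrt (((1 + p * r\<^sup>2 * exp (- c * t))\<^sup>2 - 1) / k)"
  have mono: "?\<beta> r t < ?\<beta> r' t'"
    if "p * r\<^sup>2 * exp (- c * t) < p * r'\<^sup>2 * exp (- c * t')" for r t r' t'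
  proof -
    have "0 \<le> p * r\<^sup>2 * exp (- c * t)" using assms by simp
    then have "(1 + p * r\<^sup>2 * exp (- c * t))\<^sup>2 < (1 + p * r'\<^sup>2 * exp (- c * t'))\<^sup>2"
      using that by (intro power_strict_mono) auto
    then show ?thesis using assms by (intro real_sqrt_less_mono divide_strict_right_mono) auto
  qed
  have nonneg: "?\<beta> r t \<ge> 0" for r t
  proof -
    have "1\<^sup>2 \<le> (1 + p * r\<^sup>2 * exp (- c * t))\<^sup>2" using assms by (intro power_mono) auto
    then show ?thesis using assms by simp
  qed
  have zero: "?\<beta> 0 t = 0" for t by simp
  have "continuous_on ({0..} \<times> {0..}) (\<lambda>(r, t). ?\<beta> r t)"
    unfolding split_beta using assms by (intro continuous_intros) auto
  moreover have "(\<lambda>r. ?\<beta> r t) \<in> class_K" for t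
  proof -
    have sm: "?\<beta> r t < ?\<beta> s t" if "0 \<le> r" "r < s" for r s
      using that assms by (intro mono mult_strict_right_mono mult_strict_left_mono power_strict_mono) auto
    have "continuous_on {0..} (\<lambda>r. ?\<beta> r t)"
      using assms by (intro continuous_intros) auto
    moreover have "?\<beta> r t > 0" if "r > 0" for r
      using sm[of 0 r] zero[of t] that by simp
    moreover have "strict_mono_on {0..} (\<lambda>r. ?\<beta> r t)"
      using sm by (auto intro: strict_mono_onI)
    ultimately show ?thesis using zero by (auto simp: class_K_def class_P_def)
  qed
  moreover have "?\<beta> r \<in> class_L" if "r > 0" for r
  proof -
    have "?\<beta> r t < ?\<beta> r s" if "s < t" for s t
      using that assms \<open>r > 0\<close> by (intro mono mult_strict_left_mono) auto
    moreover have "continuous_on {0..} (?\<beta> r)"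
      using assms by (intro continuous_intros) auto
    moreover have "((\<lambda>t. ?\<beta> r t) \<longlongrightarrow> sqrt (((1 + p * r\<^sup>2 * 0)\<^sup>2 - 1) / k)) at_top"
    proof -
      have "filterlim (\<lambda>t. - c * t) at_bot at_top"
        using assms by (intro filterlim_tendsto_neg_mult_at_bot[OF tendsto_const]) (auto intro: filterlim_ident)
      from filterlim_compose[OF exp_at_bot this] show ?thesis
        using assms by (intro tendsto_intros) auto
    qed
    ultimately show ?thesis using nonneg by (auto simp: class_L_def)
  qed
  ultimately show ?thesis by (auto simp: class_KL_def)
qed

section \<open>Mild solutions of Lipschitz equations\<close>

lemma mild_solutionD:
  assumes "mild_solution T f u I x"
  shows "continuous_on I x"
    and "t \<in> I \<Longrightarrow> (\<lambda>s. T (t - s) (f (x s) (u s))) integrable_on {0..t}"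
    and "t \<in> I \<Longrightarrow> x t = T t (x 0) + integral {0..t} (\<lambda>s. T (t - s) (f (x s) (u s)))"
  using assms unfolding mild_solution_def by blast+

lemma mild_solution_subset:
  assumes "mild_solution T f u I x" "J \<subseteq> I"
  shows "mild_solution T f u J x"
  using assms continuous_on_subset[of I x J] unfolding mild_solution_def by blast

text \<open>Two solutions are compared in the norm weighted by \<open>exp (- c s)\<close>, for which the
  integral operator is a contraction once \<open>c\<close> is large; no Gronwall inequality is needed.\<close>

lemma mild_solution_unique:
  assumes M: "M > 0" "\<And>t x. t \<ge> 0 \<Longrightarrow> norm (T t x) \<le> M * norm x"
    and lin: "\<And>t. t \<ge> 0 \<Longrightarrow> bounded_linear (T t)"
    and f: "lipschitz_on_bounded_sets f"
    and x: "mild_solution T f u {0..\<tau>} x" and y: "mild_solution T f u {0..\<tau>} y"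
    and init: "x 0 = y 0" and t: "t \<in> {0..\<tau>}"
  shows "x t = y t"
proof -
  note cx = mild_solutionD(1)[OF x] and cy = mild_solutionD(1)[OF y]
  have "bounded (x ` {0..\<tau>})" "bounded (y ` {0..\<tau>})"
    using cx cy by (auto intro!: compact_imp_bounded compact_continuous_image)
  then obtain R1 R2 where R12: "\<forall>s\<in>{0..\<tau>}. norm (x s) \<le> R1" "\<forall>s\<in>{0..\<tau>}. norm (y s) \<le> R2"
    by (auto simp: bounded_iff)
  define R where "R = max 1 (max R1 R2)"
  have R: "R > 0" "\<And>s. s \<in> {0..\<tau>} \<Longrightarrow> norm (x s) \<le> R" "\<And>s. s \<in> {0..\<tau>} \<Longrightarrow> norm (y s) \<le> R"
    using R12 by (auto simp: R_def le_max_iff_disj)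
  obtain L where L: "L > 0" "\<And>x y v. norm x \<le> R \<Longrightarrow> norm y \<le> R \<Longrightarrow> norm (f y v - f x v) \<le> L * norm (y - x)"
    using f R(1) unfolding lipschitz_on_bounded_sets_def by meson
  \<comment> \<open>With this weight \<open>M * L / c = 1 / 2\<close>, so the maximum
    \<open>d r\<close> of the weighted difference satisfies \<open>d r \<le> d r / 2\<close> and
    cannot be positive.\<close>
  define c where "c = 2 * M * L"
  have c: "c > 0" using M L by (simp add: c_def)
  define d where "d s = exp (- c * s) * norm (x s - y s)" for s
  have "continuous_on {0..\<tau>} d"
    unfolding d_def by (intro continuous_intros cx cy)
  moreover have "{0..\<tau>} \<noteq> {}" using t by auto
  ultimately obtain r where r: "r \<in> {0..\<tau>}" "\<And>s. s \<in> {0..\<tau>} \<Longrightarrow> d s \<le> d r"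
    using continuous_attains_sup[of "{0..\<tau>}" d] by auto
  let ?h = "\<lambda>s. T (r - s) (f (x s) (u s)) - T (r - s) (f (y s) (u s))"
  note ix = mild_solutionD(2)[OF x r(1)] and iy = mild_solutionD(2)[OF y r(1)]
  have "x r - y r = integral {0..r} ?h"
    unfolding mild_solutionD(3)[OF x r(1)] mild_solutionD(3)[OF y r(1)]
    using init ix iy by (simp add: Henstock_Kurzweil_Integration.integral_diff)
  also have "norm \<dots> \<le> integral {0..r} (\<lambda>s. M * L * d r * exp (c * s))"
  proof (rule integral_norm_bound_integral)
    show "?h integrable_on {0..r}" by (intro integrable_diff ix iy)
    show "(\<lambda>s. M * L * d r * exp (c * s)) integrable_on {0..r}"
      by (intro integrable_continuous_real continuous_intros)
    fix s assume s: "s \<in> {0..r}"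
    then have s': "s \<in> {0..\<tau>}" using r(1) by auto
    have "?h s = T (r - s) (f (x s) (u s) - f (y s) (u s))"
      using lin[of "r - s"] s by (simp add: linear_diff bounded_linear.linear)
    also have "norm \<dots> \<le> M * norm (f (x s) (u s) - f (y s) (u s))"
      using s by (intro M) auto
    also have "\<dots> \<le> M * (L * norm (x s - y s))"
      using M(1) s' by (intro mult_left_mono L R) auto
    also have "norm (x s - y s) = d s * exp (c * s)"
      by (simp add: d_def flip: exp_add)
    also have "M * (L * (d s * exp (c * s))) \<le> M * (L * (d r * exp (c * s)))"
      using M(1) L(1) s' by (intro mult_left_mono mult_right_mono r) auto
    finally show "norm (?h s) \<le> M * L * d r * exp (c * s)" by (simp add: mult.assoc)
  qed
  also have "\<dots> = M * L * d r * ((exp (c * r) - 1) / c)"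
    using integral_exp_mult[OF c, of r] r(1) by simp
  also have "\<dots> = d r / 2 * (exp (c * r) - 1)"
    using M(1) L(1) by (simp add: c_def)
  also have "\<dots> \<le> d r / 2 * exp (c * r)"
    by (intro mult_left_mono) (auto simp: d_def)
  finally have "exp (- c * r) * norm (x r - y r) \<le> exp (- c * r) * (d r / 2 * exp (c * r))"
    by (intro mult_left_mono) auto
  then have "d r \<le> d r / 2 * (exp (- c * r) * exp (c * r))"
    by (simp only: d_def mult_ac)
  then have "d r \<le> 0" by (simp flip: exp_add)
  with r(2)[OF t] have "d t \<le> 0" by linarith
  then show ?thesis by (simp add: d_def mult_le_0_iff not_le)
qed

text \<open>The definite description in \<open>phi\<close> ranges over solutions on
  \<open>{0..t}\<close>, so a solution on a longer interval is first restricted; uniqueness then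
  makes the description proper.\<close>

lemma phi_eq:
  assumes M: "M > 0" "\<And>t x. t \<ge> 0 \<Longrightarrow> norm (T t x) \<le> M * norm x"
    and lin: "\<And>t. t \<ge> 0 \<Longrightarrow> bounded_linear (T t)"
    and f: "lipschitz_on_bounded_sets f"
    and x: "mild_solution T f u {0..\<tau>} x" and t: "t \<in> {0..\<tau>}"
  shows "phi T f t (x 0) u = x t"
proof -
  have xt: "mild_solution T f u {0..t} x"
    by (rule mild_solution_subset[OF x]) (use t in auto)
  show ?thesis
    unfolding phi_def
  proof (rule the_equality)
    show "\<exists>y. mild_solution T f u {0..t} y \<and> y 0 = x 0 \<and> y t = x t"
      using xt by blast
    fix z assume "\<exists>y. mild_solution T f u {0..t} y \<and> y 0 = x 0 \<and> y t = z"
    then obtain y where y: "mild_solution T f u {0..t} y" "y 0 = x 0" "y t = z" by blast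
    have "y t = x t"
      by (rule mild_solution_unique[OF M lin f y(1) xt y(2)]) (use t in auto)
    with y(3) show "z = x t" by simp
  qed
qed

lemma continuous_on_atLeast_0:
  assumes "\<And>\<tau>. \<tau> \<ge> 0 \<Longrightarrow> continuous_on {0..\<tau>} (g :: real \<Rightarrow> 'a::topological_space)"
  shows "continuous_on {0..} g"
  unfolding continuous_on_eq_continuous_within
proof
  fix t :: real assume t: "t \<in> {0..}"
  have "continuous (at t within {0..t + 1}) g"
    using assms[of "t + 1"] t by (auto simp: continuous_on_eq_continuous_within)
  moreover have "at t within {0..} = at t within {0..t + 1}"
    by (rule at_within_nhd[of t "{..<t + 1}"]) auto
  ultimately show "continuous (at t within {0..}) g" by simp
qed

text \<open>Solutions on the intervals \<open>{0..\<tau>}\<close> are glued without choosing a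
  compatible family, because each of them agrees with \<open>phi\<close> where it lives.\<close>

lemma mild_solution_phi:
  assumes M: "M > 0" "\<And>t x. t \<ge> 0 \<Longrightarrow> norm (T t x) \<le> M * norm x"
    and lin: "\<And>t. t \<ge> 0 \<Longrightarrow> bounded_linear (T t)"
    and f: "lipschitz_on_bounded_sets f"
    and ex: "\<And>\<tau>. \<tau> \<ge> 0 \<Longrightarrow> \<exists>x. mild_solution T f u {0..\<tau>} x \<and> x 0 = x0"
  shows "mild_solution T f u {0..} (\<lambda>t. phi T f t x0 u)" "phi T f 0 x0 u = x0"
proof -
  let ?X = "\<lambda>t. phi T f t x0 u"
  have *: "continuous_on {0..\<tau>} ?X \<and> ?X 0 = x0 \<and>
      (\<lambda>s. T (\<tau> - s) (f (?X s) (u s))) integrable_on {0..\<tau>} \<and>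
      ?X \<tau> = T \<tau> (?X 0) + integral {0..\<tau>} (\<lambda>s. T (\<tau> - s) (f (?X s) (u s)))"
    if \<tau>: "\<tau> \<ge> 0" for \<tau>
  proof -
    obtain x where x: "mild_solution T f u {0..\<tau>} x" "x 0 = x0"
      using ex[OF \<tau>] by blast
    have X: "?X s = x s" if "s \<in> {0..\<tau>}" for s
      using phi_eq[OF M lin f x(1) that] x(2) by simp
    have \<tau>': "\<tau> \<in> {0..\<tau>}" "0 \<in> {0..\<tau>}" using \<tau> by auto
    have "(\<lambda>s. T (\<tau> - s) (f (?X s) (u s))) integrable_on {0..\<tau>}"
      by (rule integrable_eq[OF mild_solutionD(2)[OF x(1) \<tau>'(1)]]) (simp only: X)
    moreover have "?X \<tau> = T \<tau> (?X 0) + integral {0..\<tau>} (\<lambda>s. T (\<tau> - s) (f (?X s) (u s)))"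
    proof -
      have "?X \<tau> = x \<tau>" by (rule X[OF \<tau>'(1)])
      also have "\<dots> = T \<tau> (x 0) + integral {0..\<tau>} (\<lambda>s. T (\<tau> - s) (f (x s) (u s)))"
        by (rule mild_solutionD(3)[OF x(1) \<tau>'(1)])
      also have "x 0 = ?X 0" by (rule X[OF \<tau>'(2), symmetric])
      also have "integral {0..\<tau>} (\<lambda>s. T (\<tau> - s) (f (x s) (u s)))
          = integral {0..\<tau>} (\<lambda>s. T (\<tau> - s) (f (?X s) (u s)))"
        by (intro integral_cong) (simp only: X)
      finally show ?thesis .
    qed
    moreover have "continuous_on {0..\<tau>} ?X"
      by (rule continuous_on_eq[OF mild_solutionD(1)[OF x(1)]]) (rule X[symmetric])
    moreover have "?X 0 = x0" using X[OF \<tau>'(2)] x(2) by (rule trans)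
    ultimately show ?thesis by (intro conjI)
  qed
  show "mild_solution T f u {0..} ?X"
    unfolding mild_solution_def
  proof (intro conjI ballI)
    show "continuous_on {0..} ?X" by (rule continuous_on_atLeast_0) (rule *[THEN conjunct1])
    fix t :: real assume "t \<in> {0..}"
    then have "t \<ge> 0" by simp
    from this[THEN *, THEN conjunct2, THEN conjunct2, THEN conjunct1]
    show "(\<lambda>s. T (t - s) (f (?X s) (u s))) integrable_on {0..t}" .
    from \<open>t \<ge> 0\<close>[THEN *, THEN conjunct2, THEN conjunct2, THEN conjunct2]
    show "?X t = T t (?X 0) + integral {0..t} (\<lambda>s. T (t - s) (f (?X s) (u s)))" .
  qed
  show "phi T f 0 x0 u = x0" by (rule *[OF order_refl, THEN conjunct2, THEN conjunct1])
qed

section \<open>Strongly continuous semigroups\<close>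

locale strongly_continuous_semigroup =
  fixes T :: "real \<Rightarrow> 'x::banach \<Rightarrow> 'x"
  assumes bounded_linear_T: "t \<ge> 0 \<Longrightarrow> bounded_linear (T t)"
    and T_0: "T 0 x = x"
    and T_add: "s \<ge> 0 \<Longrightarrow> t \<ge> 0 \<Longrightarrow> T (s + t) x = T s (T t x)"
    and tendsto_T_0: "((\<lambda>t. T t x) \<longlongrightarrow> x) (at_right 0)"
begin

text \<open>Otherwise there are times \<open>t n\<close> tending to 0 at which the bound
  \<open>Suc n\<close> fails. Every orbit converges along these times and is therefore bounded, so
  uniform boundedness bounds the operators as well.\<close>

lemma bounded_near_0: "\<exists>\<delta>>0. \<exists>M>0. \<forall>t\<in>{0..\<delta>}. \<forall>x. norm (T t x) \<le> M * norm x"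
proof (rule ccontr)
  assume neg: "\<not> ?thesis"
  have "\<exists>t. 0 \<le> t \<and> t \<le> inverse (Suc n) \<and> (\<exists>x. norm (T t x) > Suc n * norm x)" for n
  proof -
    have "inverse (real (Suc n)) > 0" "real (Suc n) > 0" by auto
    with neg have "\<not> (\<forall>t\<in>{0..inverse (real (Suc n))}. \<forall>x. norm (T t x) \<le> real (Suc n) * norm x)"
      by blast
    then show ?thesis by (auto simp: not_le)
  qed
  then obtain t where t: "\<And>n. 0 \<le> t n" "\<And>n. t n \<le> inverse (Suc n)"
    "\<And>n. \<exists>x. norm (T (t n) x) > Suc n * norm x"
    by metis
  \<comment> \<open>\<open>T 0\<close> is the identity and obeys the bound \<open>Suc n\<close>;
    hence the times are positive, as a limit from the right requires.\<close>
  have ne: "t n \<noteq> 0" for n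
  proof
    assume "t n = 0"
    moreover obtain x where "norm (T (t n) x) > Suc n * norm x" using t(3) by blast
    ultimately have "norm x > Suc n * norm x" by (simp only: T_0)
    moreover have "1 * norm x \<le> Suc n * norm x" by (rule mult_right_mono) auto
    ultimately show False by simp
  qed
  have pos: "t n > 0" for n using t(1)[of n] ne by (simp add: order_less_le)
  have "t \<longlonglongrightarrow> 0"
    by (rule tendsto_sandwich[OF _ _ tendsto_const LIMSEQ_inverse_real_of_nat]) (use t in auto)
  then have lim: "filterlim t (at_right 0) sequentially"
    using pos ne by (simp add: filterlim_at)
  have "\<exists>c. \<forall>n\<in>UNIV. norm (T (t n) x) \<le> c" for x
  proof -
    have "(\<lambda>n. T (t n) x) \<longlonglongrightarrow> x"
      by (rule filterlim_compose[OF tendsto_T_0 lim])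
    then have "Bseq (\<lambda>n. T (t n) x)" by (rule convergent_imp_Bseq[OF convergentI])
    then show ?thesis by (auto simp: Bseq_def)
  qed
  then obtain M where M: "\<And>n x. norm (T (t n) x) \<le> M * norm x"
    using uniform_boundedness[of UNIV "\<lambda>n. T (t n)"] bounded_linear_T t(1) by auto
  obtain n where "M \<le> real n" using real_arch_simple by blast
  obtain x where "norm (T (t n) x) > Suc n * norm x" using t(3) by blast
  moreover have "M * norm x \<le> Suc n * norm x"
    using \<open>M \<le> real n\<close> by (intro mult_right_mono) auto
  ultimately show False using M[of n x] by linarith
qed

text \<open>The semigroup law reaches times up to \<open>n * \<delta>\<close> in \<open>n\<close>
  steps of length at most \<open>\<delta>\<close>, each costing a factor \<open>M\<close>.\<close>

lemma bounded_on_interval: "\<exists>M>0. \<forall>t\<in>{0..\<tau>}. \<forall>x. norm (T t x) \<le> M * norm x"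
proof -
  obtain \<delta> M where \<delta>: "\<delta> > 0" and M: "M > 0" "\<And>t x. t \<in> {0..\<delta>} \<Longrightarrow> norm (T t x) \<le> M * norm x"
    using bounded_near_0 by blast
  have *: "\<exists>N>0. \<forall>t\<in>{0..real n * \<delta>}. \<forall>x. norm (T t x) \<le> N * norm x" for n
  proof (induction n)
    case 0
    then show ?case by (auto simp: T_0 intro!: exI[of _ 1])
  next
    case (Suc n)
    then obtain N where N: "N > 0" "\<And>t x. t \<in> {0..real n * \<delta>} \<Longrightarrow> norm (T t x) \<le> N * norm x"
      by blast
    have "norm (T t x) \<le> M * N * norm x" if t: "t \<in> {0..real (Suc n) * \<delta>}" for t x
    proof -
      define r where "r = min t \<delta>"
      have r: "0 \<le> r" "r \<le> t" "r \<le> \<delta>" "t - r \<le> real n * \<delta>"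
        using t \<delta> by (auto simp: r_def min_def algebra_simps)
      have "T t x = T r (T (t - r) x)"
        using T_add[of r "t - r" x] r by simp
      moreover have "norm (T r (T (t - r) x)) \<le> M * norm (T (t - r) x)"
        using r by (intro M) auto
      moreover have "M * norm (T (t - r) x) \<le> M * (N * norm x)"
        using r M(1) by (intro mult_left_mono N) auto
      ultimately show ?thesis by (simp add: mult.assoc)
    qed
    then show ?case using M(1) N(1) by (intro exI[of _ "M * N"]) auto
  qed
  obtain n where "\<tau> / \<delta> \<le> real n" using real_arch_simple by blast
  then have "\<tau> \<le> real n * \<delta>" using \<delta> by (simp add: field_simps)
  moreover obtain N where "N > 0" "\<forall>t\<in>{0..real n * \<delta>}. \<forall>x. norm (T t x) \<le> N * norm x"
    using * by blast
  ultimately show ?thesis by (intro exI[of _ N]) auto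
qed

text \<open>There are no operators for negative times, so left and right continuity are treated
  together: the earlier time \<open>m\<close> factors out of the difference, leaving
  \<open>T h x - x\<close> for the time gap \<open>h\<close>, and \<open>T m\<close> is bounded on
  compact time intervals.\<close>

lemma tendsto_orbit:
  assumes q: "(q \<longlongrightarrow> t) F" "eventually (\<lambda>s. q s \<ge> 0) F" and t: "t \<ge> 0"
  shows "((\<lambda>s. T (q s) x) \<longlongrightarrow> T t x) F"
proof -
  obtain M where M: "M > 0" "\<And>r y. r \<in> {0..t + 1} \<Longrightarrow> norm (T r y) \<le> M * norm y"
    using bounded_on_interval by blast
  have "continuous (at 0 within {0..}) (\<lambda>t. T t x)"
    using tendsto_T_0[of x] by (simp add: continuous_within T_0 at_within_Ici_at_right)
  moreover have "((\<lambda>s. \<bar>q s - t\<bar>) \<longlongrightarrow> 0) F"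
    using q(1) by (simp add: LIM_zero_iff tendsto_rabs_zero)
  ultimately have "((\<lambda>s. T \<bar>q s - t\<bar> x) \<longlongrightarrow> T 0 x) F"
    by (intro continuous_within_tendsto_compose'[of 0 "{0..}" "\<lambda>t. T t x"]) auto
  then have "((\<lambda>s. norm (T \<bar>q s - t\<bar> x - x)) \<longlongrightarrow> 0) F"
    by (simp add: T_0 LIM_zero_iff tendsto_norm_zero)
  then have lim: "((\<lambda>s. M * norm (T \<bar>q s - t\<bar> x - x)) \<longlongrightarrow> 0) F"
    by (rule tendsto_mult_right_zero)
  have "eventually (\<lambda>s. q s < t + 1) F"
    using q(1) by (rule order_tendstoD) simp
  with q(2) have "eventually (\<lambda>s. norm (T (q s) x - T t x) \<le> M * norm (T \<bar>q s - t\<bar> x - x)) F"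
  proof eventually_elim
    case (elim s)
    define m h where "m = min (q s) t" and "h = \<bar>q s - t\<bar>"
    have m: "m \<in> {0..t + 1}" "h \<ge> 0" using elim t by (auto simp: m_def h_def)
    interpret bounded_linear "T m" using m by (intro bounded_linear_T) simp
    have eq: "T (m + h) x - T m x = T m (T h x - x)"
      using m by (simp add: T_add diff)
    have "norm (T (q s) x - T t x) = norm (T (m + h) x - T m x)"
    proof (cases "q s \<le> t")
      case True
      then have "m = q s" "m + h = t" by (auto simp: m_def h_def)
      then show ?thesis by (simp add: norm_minus_commute)
    next
      case False
      then have "m = t" "m + h = q s" by (auto simp: m_def h_def)
      then show ?thesis by simp
    qed
    then show ?case using M(2)[OF m(1), of "T h x - x"] by (simp add: eq flip: h_def)
  qed
  from Lim_null_comparison[OF this lim] show ?thesis by (simp add: LIM_zero_iff)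
qed

text \<open>The bound on compact time intervals upgrades continuity of single orbits to joint
  continuity in time and vector, as integrands with a moving vector require.\<close>

lemma tendsto_T:
  assumes q: "(q \<longlongrightarrow> t) F" "eventually (\<lambda>s. q s \<ge> 0) F" and t: "t \<ge> 0"
    and g: "(g \<longlongrightarrow> x) F"
  shows "((\<lambda>s. T (q s) (g s)) \<longlongrightarrow> T t x) F"
proof -
  obtain M where M: "M > 0" "\<And>r y. r \<in> {0..t + 1} \<Longrightarrow> norm (T r y) \<le> M * norm y"
    using bounded_on_interval by blast
  have "((\<lambda>s. norm (g s - x)) \<longlongrightarrow> 0) F"
    using g by (simp add: LIM_zero_iff tendsto_norm_zero)
  then have lim: "((\<lambda>s. M * norm (g s - x)) \<longlongrightarrow> 0) F"
    by (rule tendsto_mult_right_zero)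
  have "eventually (\<lambda>s. q s < t + 1) F"
    using q(1) by (rule order_tendstoD) simp
  with q(2) have "eventually (\<lambda>s. norm (T (q s) (g s) - T (q s) x) \<le> M * norm (g s - x)) F"
  proof eventually_elim
    case (elim s)
    then show ?case
      using M(2)[of "q s" "g s - x"] by (simp add: linear_diff bounded_linear.linear bounded_linear_T)
  qed
  from tendsto_add[OF Lim_null_comparison[OF this lim] tendsto_orbit[OF q t, of x]]
  show ?thesis by simp
qed

lemma continuous_on_T:
  assumes "continuous_on S q" "continuous_on S g" and nn: "\<And>s. s \<in> S \<Longrightarrow> q s \<ge> 0"
  shows "continuous_on S (\<lambda>s. T (q s) (g s))"
  unfolding continuous_on_def
proof
  fix s assume s: "s \<in> S"
  show "((\<lambda>s. T (q s) (g s)) \<longlongrightarrow> T (q s) (g s)) (at s within S)"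
  proof (rule tendsto_T)
    show "\<forall>\<^sub>F r in at s within S. 0 \<le> q r"
      by (auto simp: eventually_at_filter intro!: always_eventually nn)
  qed (use assms s in \<open>auto simp: continuous_on_def\<close>)
qed

section \<open>Convolution of the semigroup with a forcing term\<close>

definition convolution :: "(real \<Rightarrow> 'x) \<Rightarrow> real \<Rightarrow> 'x" where
  "convolution g t = integral {0..t} (\<lambda>s. T (t - s) (g s))"

lemma continuous_on_convolution_integrand:
  assumes "continuous_on {0..} g"
  shows "continuous_on {0..t} (\<lambda>s. T (t - s) (g s))"
  by (intro continuous_on_T continuous_intros continuous_on_subset[OF assms]) auto

lemma convolution_rescale:
  assumes "continuous_on {0..} g" "t \<ge> 0"
  shows "convolution g t = t *\<^sub>R integral {0..1} (\<lambda>r. T (t - t * r) (g (t * r)))"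
  using integral_rescale[OF assms(2), of 0 "\<lambda>s. T (t - s) (g s)"]
    continuous_on_convolution_integrand[OF assms(1)]
  by (simp add: convolution_def)

text \<open>At \<open>t = 0\<close> the integrand is the constant \<open>g 0\<close>; continuity
  there gives the right derivative of the convolution at 0.\<close>

lemma continuous_on_rescaled_convolution:
  assumes g: "continuous_on {0..} g"
  shows "continuous_on {0..} (\<lambda>t. integral {0..1} (\<lambda>r. T (t - t * r) (g (t * r))))"
proof -
  have "continuous_on ({0..} \<times> {0..1}) (\<lambda>(t, r). T (t - t * r) (g (t * r)))"
    unfolding split_beta
  proof (rule continuous_on_T)
    show "continuous_on ({0..} \<times> {0..1}) (\<lambda>p::real \<times> real. g (fst p * snd p))"
      by (rule continuous_on_compose2[OF g]) (auto intro!: continuous_intros)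
    show "0 \<le> fst p - fst p * snd p" if "p \<in> {0..} \<times> {0..1}" for p :: "real \<times> real"
      using that mult_left_mono[of "snd p" 1 "fst p"] by auto
  qed (intro continuous_intros)
  from integral_continuous_on_param[of "{0..}" 0 1, OF this[folded box_real(2)]]
  show ?thesis by simp
qed

lemma continuous_on_convolution:
  assumes g: "continuous_on {0..} g"
  shows "continuous_on {0..} (convolution g)"
proof -
  have "continuous_on {0..} (\<lambda>t. t *\<^sub>R integral {0..1} (\<lambda>r. T (t - t * r) (g (t * r))))"
    by (intro continuous_intros continuous_on_rescaled_convolution g)
  then show ?thesis
    by (rule continuous_on_eq) (simp add: convolution_rescale g)
qed

lemma convolution_divide_tendsto:
  assumes g: "continuous_on {0..} g"
  shows "((\<lambda>h. convolution g h /\<^sub>R h) \<longlongrightarrow> g 0) (at_right 0)"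
proof -
  have "((\<lambda>t. integral {0..1} (\<lambda>r. T (t - t * r) (g (t * r)))) \<longlongrightarrow> g 0) (at_right 0)"
    using continuous_on_rescaled_convolution[OF g]
    by (force simp: continuous_on_def at_within_Ici_at_right T_0 dest: bspec[of _ _ 0])
  moreover have "eventually (\<lambda>h. h > (0::real)) (at_right 0)"
    by (simp add: eventually_at_right_less)
  then have "eventually (\<lambda>h. integral {0..1} (\<lambda>r. T (h - h * r) (g (h * r))) = convolution g h /\<^sub>R h) (at_right 0)"
    by eventually_elim (simp add: convolution_rescale g)
  ultimately show ?thesis
    by (rule Lim_transform_eventually)
qed

text \<open>The restart property of the variation of constants formula: up to time \<open>t\<close>
  the factor \<open>T h\<close> comes out of the integral by the semigroup law, and the rest is a
  convolution with the shifted forcing term.\<close>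

lemma convolution_add:
  assumes g: "continuous_on {0..} g" and "t \<ge> 0" "h \<ge> 0"
  shows "convolution g (t + h) = T h (convolution g t) + convolution (\<lambda>s. g (t + s)) h"
proof -
  let ?G = "\<lambda>s. T (t + h - s) (g s)"
  have cont: "continuous_on {0..t + h} ?G"
    by (rule continuous_on_convolution_integrand[OF g])
  have "convolution g (t + h) = integral {0..t} ?G + integral {t..t + h} ?G"
    unfolding convolution_def using assms
    by (intro Henstock_Kurzweil_Integration.integral_combine[symmetric] integrable_continuous_real cont) auto
  also have "integral {0..t} ?G = integral {0..t} (T h \<circ> (\<lambda>s. T (t - s) (g s)))"
    using \<open>h \<ge> 0\<close> by (intro integral_cong) (auto simp: algebra_simps simp flip: T_add)
  also have "\<dots> = T h (convolution g t)"
    unfolding convolution_def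
    by (intro integral_linear integrable_continuous_real continuous_on_convolution_integrand g
        bounded_linear_T \<open>h \<ge> 0\<close>)
  also have "integral {t..t + h} ?G = convolution (\<lambda>s. g (t + s)) h"
  proof -
    have g': "continuous_on {0..} (\<lambda>s. g (t + s))"
      by (rule continuous_on_compose2[OF g]) (use \<open>t \<ge> 0\<close> in \<open>auto intro!: continuous_intros\<close>)
    have "continuous_on {t..t + h} ?G"
      by (rule continuous_on_subset[OF cont]) (use \<open>t \<ge> 0\<close> in auto)
    from integral_rescale[OF \<open>h \<ge> 0\<close> this] show ?thesis
      by (simp add: convolution_rescale[OF g' \<open>h \<ge> 0\<close>])
  qed
  finally show ?thesis .
qed

lemma convolution_diff:
  assumes "continuous_on {0..} g" "continuous_on {0..} h" "t \<ge> 0"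
  shows "convolution g t - convolution h t = convolution (\<lambda>s. g s - h s) t"
proof -
  have "convolution (\<lambda>s. g s - h s) t = integral {0..t} (\<lambda>s. T (t - s) (g s) - T (t - s) (h s))"
    unfolding convolution_def
    by (intro integral_cong) (simp add: linear_diff bounded_linear.linear bounded_linear_T)
  then show ?thesis
    using assms by (simp add: convolution_def Henstock_Kurzweil_Integration.integral_diff
        integrable_continuous_real continuous_on_convolution_integrand)
qed

text \<open>Integrating \<open>exp (c * s)\<close> produces the factor \<open>1 / c\<close>, so in
  the weighted norm a large \<open>c\<close> makes the integral operator small on the whole
  half-line.\<close>

lemma norm_convolution_le:
  assumes M: "M > 0" "\<And>t x. t \<ge> 0 \<Longrightarrow> norm (T t x) \<le> M * norm x"
    and g: "continuous_on {0..} g" "\<And>s. s \<ge> 0 \<Longrightarrow> norm (g s) \<le> B * exp (c * s)"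
    and "c > 0" "t \<ge> 0" "B \<ge> 0"
  shows "exp (- c * t) * norm (convolution g t) \<le> M * B / c"
proof -
  have "norm (convolution g t) \<le> integral {0..t} (\<lambda>s. M * B * exp (c * s))"
    unfolding convolution_def
  proof (rule integral_norm_bound_integral)
    show "(\<lambda>s. T (t - s) (g s)) integrable_on {0..t}"
      by (intro integrable_continuous_real continuous_on_convolution_integrand g)
    show "(\<lambda>s. M * B * exp (c * s)) integrable_on {0..t}"
      by (intro integrable_continuous_real continuous_intros)
    fix s assume s: "s \<in> {0..t}"
    then have "norm (T (t - s) (g s)) \<le> M * norm (g s)" by (intro M) auto
    also have "\<dots> \<le> M * (B * exp (c * s))" using M(1) s by (intro mult_left_mono g) auto
    finally show "norm (T (t - s) (g s)) \<le> M * B * exp (c * s)" by (simp add: mult.assoc)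
  qed
  also have "\<dots> = M * B * ((exp (c * t) - 1) / c)"
    using integral_exp_mult[OF \<open>c > 0\<close> \<open>t \<ge> 0\<close>] by simp
  also have "\<dots> \<le> M * B * (exp (c * t) / c)"
    using assms by (intro mult_left_mono divide_right_mono) auto
  finally have "exp (- c * t) * norm (convolution g t) \<le> exp (- c * t) * (M * B * (exp (c * t) / c))"
    by (intro mult_left_mono) auto
  also have "\<dots> = M * B / c * (exp (- c * t) * exp (c * t))" by simp
  finally show ?thesis by (simp flip: exp_add)
qed

text \<open>Banach's fixed point theorem is applied to bounded continuous \<open>y\<close>, where
  \<open>x t = exp (c * t) *\<^sub>R y t\<close>. The contraction factor is
  \<open>M * L / c = 1 / 2\<close> on the entire half-line, so no local solutions have to be
  continued. The bound \<open>b\<close> keeps the image of \<open>y\<close> bounded.\<close>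

lemma mild_existence:
  fixes F :: "real \<Rightarrow> 'x \<Rightarrow> 'x"
  assumes M: "M > 0" "\<And>t x. t \<ge> 0 \<Longrightarrow> norm (T t x) \<le> M * norm x"
    and cont: "continuous_on ({0..} \<times> UNIV) (\<lambda>(s, x). F s x)"
    and L: "L > 0" "\<And>s x y. s \<ge> 0 \<Longrightarrow> norm (F s x - F s y) \<le> L * norm (x - y)"
    and b: "\<And>s. s \<ge> 0 \<Longrightarrow> norm (F s 0) \<le> b"
  obtains x where "continuous_on {0..} x" "\<And>t. t \<ge> 0 \<Longrightarrow> x t = T t x0 + convolution (\<lambda>s. F s (x s)) t"
proof -
  define c where "c = 2 * M * L"
  have c: "c > 0" using M L by (simp add: c_def)
  have "b \<ge> 0" using b[of 0] norm_ge_zero[of "F 0 0"] by linarith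
  define N where "N y s = F s (exp (c * s) *\<^sub>R apply_bcontfun y s)" for y s
  have cN: "continuous_on {0..} (N y)" for y
    unfolding N_def
    by (rule continuous_on_compose2[OF cont, of _ "\<lambda>s. (s, exp (c * s) *\<^sub>R apply_bcontfun y s)", simplified])
      (auto intro!: continuous_intros)
  have N_lip: "norm (N y s - N z s) \<le> L * dist y z * exp (c * s)" if "s \<ge> 0" for y z s
  proof -
    have "norm (N y s - N z s) \<le> L * norm (exp (c * s) *\<^sub>R apply_bcontfun y s - exp (c * s) *\<^sub>R apply_bcontfun z s)"
      unfolding N_def by (rule L(2)[OF that])
    also have "\<dots> = L * dist (apply_bcontfun y s) (apply_bcontfun z s) * exp (c * s)"
      by (simp add: dist_norm flip: scaleR_diff_right)
    also have "\<dots> \<le> L * dist y z * exp (c * s)"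
      using L(1) by (intro mult_right_mono mult_left_mono dist_bounded) auto
    finally show ?thesis .
  qed
  have N_bound: "norm (N y s) \<le> (b + L * dist y 0) * exp (c * s)" if "s \<ge> 0" for y s
  proof -
    have "norm (N y s) \<le> norm (N 0 s) + norm (N y s - N 0 s)"
      using norm_triangle_ineq[of "N 0 s" "N y s - N 0 s"] by simp
    moreover have "norm (N 0 s) \<le> b * exp (c * s)"
    proof -
      have "norm (N 0 s) \<le> b * 1" using b[OF that] by (simp add: N_def)
      also have "\<dots> \<le> b * exp (c * s)" using \<open>b \<ge> 0\<close> c that by (intro mult_left_mono) auto
      finally show ?thesis .
    qed
    moreover have "norm (N y s - N 0 s) \<le> L * dist y 0 * exp (c * s)" by (rule N_lip[OF that])
    ultimately show ?thesis by (simp add: distrib_right)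
  qed
  define G where "G y t = exp (- c * t) *\<^sub>R (T t x0 + convolution (N y) t)" for y t
  have cG: "continuous_on {0..} (G y)" for y
    unfolding G_def
    by (intro continuous_intros continuous_on_T continuous_on_convolution cN) auto
  have G_bound: "norm (G y t) \<le> M * norm x0 + M * (b + L * dist y 0) / c" if t: "t \<ge> 0" for y t
  proof -
    have "norm (G y t) \<le> exp (- c * t) * norm (T t x0) + exp (- c * t) * norm (convolution (N y) t)"
      unfolding G_def using norm_triangle_ineq[of "T t x0" "convolution (N y) t"]
      by (simp flip: distrib_left)
    also have "exp (- c * t) * norm (T t x0) \<le> 1 * (M * norm x0)"
      using M c t by (intro mult_mono) auto
    also have "exp (- c * t) * norm (convolution (N y) t) \<le> M * (b + L * dist y 0) / c"
      using \<open>b \<ge> 0\<close> L(1) by (intro norm_convolution_le M cN N_bound c t) auto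
    finally show ?thesis by simp
  qed
  \<comment> \<open>Bounded continuous functions live on the whole line here; \<open>max t 0\<close>
    extends by the value at time 0.\<close>
  define \<Phi> where "\<Phi> y = Bcontfun (\<lambda>t. G y (max t 0))" for y
  have \<Phi>: "apply_bcontfun (\<Phi> y) t = G y (max t 0)" for y t
  proof -
    have "(\<lambda>t. G y (max t 0)) \<in> bcontfun"
    proof (rule bcontfun_normI)
      show "continuous_on UNIV (\<lambda>t. G y (max t 0))"
        by (rule continuous_on_compose2[OF cG]) (auto intro!: continuous_intros)
      show "norm (G y (max t 0)) \<le> M * norm x0 + M * (b + L * dist y 0) / c" for t
        by (rule G_bound) simp
    qed
    then show ?thesis by (simp add: \<Phi>_def Bcontfun_inverse)
  qed
  have "dist (\<Phi> y) (\<Phi> z) \<le> 1 / 2 * dist y z" for y z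
  proof (rule dist_bound)
    fix t :: real
    define r where "r = max t 0"
    have r: "r \<ge> 0" by (simp add: r_def)
    have "dist (\<Phi> y t) (\<Phi> z t) = exp (- c * r) * norm (convolution (N y) r - convolution (N z) r)"
      by (simp add: \<Phi> G_def dist_norm flip: r_def scaleR_diff_right)
    also have "\<dots> \<le> M * (L * dist y z) / c"
      unfolding convolution_diff[OF cN cN r]
      using L(1) by (intro norm_convolution_le M N_lip c r continuous_intros cN) auto
    also have "\<dots> = 1 / 2 * dist y z" using M(1) L(1) by (simp add: c_def)
    finally show "dist (\<Phi> y t) (\<Phi> z t) \<le> 1 / 2 * dist y z" .
  qed
  then obtain y where y: "\<Phi> y = y"
    using banach_fix_type[of "1 / 2" \<Phi>] by auto
  define x where "x t = exp (c * t) *\<^sub>R apply_bcontfun y t" for t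
  have N: "N y = (\<lambda>s. F s (x s))" by (simp add: N_def x_def fun_eq_iff)
  show thesis
  proof (rule that)
    show "continuous_on {0..} x" unfolding x_def by (intro continuous_intros) auto
    fix t :: real assume "t \<ge> 0"
    then have "x t = exp (c * t) *\<^sub>R G y t"
      using \<Phi>[of y t] y by (simp add: x_def)
    then show "x t = T t x0 + convolution (\<lambda>s. F s (x s)) t"
      by (simp add: G_def N flip: exp_add)
  qed
qed

end

section \<open>The quadratic Lyapunov function\<close>

locale semigroup_generator = strongly_continuous_semigroup T
  for T :: "real \<Rightarrow> 'x::banach \<Rightarrow> 'x" +
  fixes D :: "'x set" and A :: "'x \<Rightarrow> 'x"
  assumes D_eq: "D = {x. \<exists>y. ((\<lambda>h. (1 / h) *\<^sub>R (T h x - x)) \<longlongrightarrow> y) (at_right 0)}"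
    and tendsto_A: "x \<in> D \<Longrightarrow> ((\<lambda>h. (1 / h) *\<^sub>R (T h x - x)) \<longlongrightarrow> A x) (at_right 0)"
begin

text \<open>The averages \<open>c t /\<^sub>R t\<close> of an orbit tend to \<open>x\<close> and lie
  in \<open>D\<close>: exchanging the roles of \<open>t\<close> and \<open>h\<close> turns their
  difference quotient into one of \<open>T t\<close> applied to averages over \<open>{0..h}\<close>,
  which converges.\<close>

lemma closure_D: "closure D = UNIV"
proof (intro equalityI subsetI UNIV_I)
  fix x
  define c where "c = convolution (\<lambda>_. x)"
  have lim: "((\<lambda>h. c h /\<^sub>R h) \<longlongrightarrow> x) (at_right 0)"
    unfolding c_def by (rule convolution_divide_tendsto) simp
  have mem: "c t /\<^sub>R t \<in> D" if t: "t > 0" for t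
  proof -
    interpret Tt: bounded_linear "T t" using t by (intro bounded_linear_T) simp
    have "((\<lambda>h. (1 / t) *\<^sub>R (T t (c h /\<^sub>R h) - c h /\<^sub>R h)) \<longlongrightarrow> (1 / t) *\<^sub>R (T t x - x)) (at_right 0)"
      by (intro tendsto_intros Tt.tendsto lim)
    moreover have "eventually (\<lambda>h. h > (0::real)) (at_right 0)"
      by (simp add: eventually_at_right_less)
    then have "eventually (\<lambda>h. (1 / t) *\<^sub>R (T t (c h /\<^sub>R h) - c h /\<^sub>R h)
        = (1 / h) *\<^sub>R (T h (c t /\<^sub>R t) - c t /\<^sub>R t)) (at_right 0)"
    proof eventually_elim
      case (elim h)
      interpret Th: bounded_linear "T h" using elim by (intro bounded_linear_T) simp
      \<comment> \<open>Both sides expand \<open>c (t + h)\<close>, in the two orders of the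
        summands.\<close>
      have "T h (c t) + c h = T t (c h) + c t"
        using convolution_add[of "\<lambda>_. x" t h] convolution_add[of "\<lambda>_. x" h t] t elim
        by (simp add: c_def add.commute)
      then have "T t (c h) - c h = T h (c t) - c t" by (simp add: algebra_simps)
      then show ?case using t elim
        by (simp add: Tt.scaleR Th.scaleR inverse_eq_divide flip: scaleR_diff_right)
    qed
    ultimately have "((\<lambda>h. (1 / h) *\<^sub>R (T h (c t /\<^sub>R t) - c t /\<^sub>R t)) \<longlongrightarrow>
        (1 / t) *\<^sub>R (T t x - x)) (at_right 0)"
      by (rule Lim_transform_eventually)
    then show ?thesis by (auto simp: D_eq)
  qed
  have "eventually (\<lambda>h. c h /\<^sub>R h \<in> closure D) (at_right 0)"
    using eventually_at_right_less[of 0]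
    by eventually_elim (use mem closure_subset in blast)
  from Lim_in_closed_set[OF closed_closure this _ lim] show "x \<in> closure D"
    by simp
qed

lemma orbit_right_derivative:
  assumes x: "x \<in> D" and t: "t \<ge> 0"
  shows "T t x \<in> D" "((\<lambda>h. (1 / h) *\<^sub>R (T (t + h) x - T t x)) \<longlongrightarrow> A (T t x)) (at_right 0)"
proof -
  interpret bounded_linear "T t" using t by (rule bounded_linear_T)
  have lim: "((\<lambda>h. T t ((1 / h) *\<^sub>R (T h x - x))) \<longlongrightarrow> T t (A x)) (at_right 0)"
    by (intro tendsto tendsto_A x)
  have pos: "eventually (\<lambda>h. h > (0::real)) (at_right 0)"
    by (simp add: eventually_at_right_less)
  then have "eventually (\<lambda>h. T t ((1 / h) *\<^sub>R (T h x - x)) = (1 / h) *\<^sub>R (T h (T t x) - T t x)) (at_right 0)"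
    by eventually_elim (use t in \<open>simp add: scaleR diff add.commute flip: T_add\<close>)
  from Lim_transform_eventually[OF lim this] show mem: "T t x \<in> D"
    by (auto simp: D_eq)
  from pos have "eventually (\<lambda>h. (1 / h) *\<^sub>R (T h (T t x) - T t x) = (1 / h) *\<^sub>R (T (t + h) x - T t x)) (at_right 0)"
    by eventually_elim (use t in \<open>simp add: add.commute flip: T_add\<close>)
  from Lim_transform_eventually[OF tendsto_A[OF mem] this]
  show "((\<lambda>h. (1 / h) *\<^sub>R (T (t + h) x - T t x)) \<longlongrightarrow> A (T t x)) (at_right 0)" .
qed

end

text \<open>From here on the setting is the underlying real Hilbert space: \<open>lyapunov\<close>
  is the real part of the operator equation, and \<open>k\<close> and \<open>p\<close> make the
  quadratic form equivalent to the squared norm.\<close>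

locale lyapunov_semigroup = semigroup_generator T D A
  for T :: "real \<Rightarrow> 'x::{real_inner, banach} \<Rightarrow> 'x" and D A +
  fixes P :: "'x \<Rightarrow> 'x" and k p :: real
  assumes bounded_linear_P: "bounded_linear P"
    and P_sym: "inner (P x) y = inner x (P y)"
    and k_pos: "k > 0" and k_le: "k * (norm x)\<^sup>2 \<le> inner (P x) x"
    and p_pos: "p > 0" and norm_P_le: "norm (P x) \<le> p * norm x"
    and lyapunov: "x \<in> D \<Longrightarrow> 2 * inner (P x) (A x) = - (norm x)\<^sup>2"
begin

definition V :: "'x \<Rightarrow> real" where "V x = inner (P x) x"

sublocale P: bounded_linear P by (rule bounded_linear_P)

lemma V_le: "V x \<le> p * (norm x)\<^sup>2"
proof -
  have "V x \<le> norm (P x) * norm x" unfolding V_def by (rule norm_cauchy_schwarz)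
  also have "\<dots> \<le> p * norm x * norm x" by (intro mult_right_mono norm_P_le) simp
  finally show ?thesis by (simp add: power2_eq_square mult.assoc)
qed

lemma V_ge: "k * (norm x)\<^sup>2 \<le> V x"
  unfolding V_def by (rule k_le)

lemma V_nonneg: "V x \<ge> 0"
proof -
  have "0 \<le> k * (norm x)\<^sup>2" using k_pos by simp
  then show ?thesis using V_ge[of x] by linarith
qed

lemma V_add: "V (x + y) = V x + 2 * inner (P x) y + V y"
  using P_sym[of y x] by (simp add: V_def P.add inner_simps inner_commute)

lemma continuous_on_V: "continuous_on S g \<Longrightarrow> continuous_on S (\<lambda>s. V (g s))"
  unfolding V_def by (intro continuous_intros P.continuous_on)

text \<open>The second order expansion of a quadratic form is exact, and its last term carries a
  factor \<open>h\<close> in the difference quotient.\<close>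

lemma V_right_derivative:
  assumes "((\<lambda>h. (1 / h) *\<^sub>R (y h - x)) \<longlongrightarrow> v) (at_right 0)"
  shows "((\<lambda>h. (V (y h) - V x) / h) \<longlongrightarrow> 2 * inner (P x) v) (at_right 0)"
proof -
  define q where "q h = (1 / h) *\<^sub>R (y h - x)" for h
  have q: "(q \<longlongrightarrow> v) (at_right 0)" using assms by (simp add: q_def [abs_def])
  have "((\<lambda>h. 2 * inner (P x) (q h) + inner (P (h *\<^sub>R q h)) (q h))
      \<longlongrightarrow> 2 * inner (P x) v + inner (P (0 *\<^sub>R v)) v) (at_right 0)"
    by (intro tendsto_intros P.tendsto q)
  moreover have "eventually (\<lambda>h. 2 * inner (P x) (q h) + inner (P (h *\<^sub>R q h)) (q h)
      = (V (y h) - V x) / h) (at_right 0)"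
    using eventually_at_right_less[of 0]
  proof eventually_elim
    case (elim h)
    then have "y h = x + h *\<^sub>R q h" by (simp add: q_def)
    then show ?case using elim
      by (simp add: V_add) (simp add: V_def P.scaleR field_simps)
  qed
  ultimately show ?thesis
    by (simp add: Lim_transform_eventually P.zero)
qed

lemma continuous_on_norm_orbit: "continuous_on {0..} (\<lambda>s. (norm (T s x))\<^sup>2)"
  by (intro continuous_intros continuous_on_T) auto

lemma V_orbit:
  assumes t: "t \<ge> 0"
  shows "V (T t x) = V x - integral {0..t} (\<lambda>s. (norm (T s x))\<^sup>2)"
proof -
  let ?I = "\<lambda>x t. integral {0..t} (\<lambda>s. (norm (T s x))\<^sup>2)"
  let ?E = "{x. V (T t x) = V x - ?I x t}"
  have "x \<in> ?E" if x: "x \<in> D" for x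
  proof -
    let ?f = "\<lambda>s. V (T s x) + ?I x s"
    have der_I: "(?I x has_real_derivative (norm (T s x))\<^sup>2) (at_right s)" if "0 \<le> s" for s
      by (rule integral_right_derivative[OF continuous_on_norm_orbit that])
    have "?f t = ?f 0"
    proof (rule right_derivative_zero_imp_eq[OF t])
      have "continuous_on {0..t} (?I x)"
        by (intro indefinite_integral_continuous_1 integrable_continuous_real
            continuous_on_subset[OF continuous_on_norm_orbit]) auto
      then show "continuous_on {0..t} ?f"
        by (intro continuous_on_add continuous_on_V continuous_on_T continuous_intros) auto
    next
      fix s :: real assume "0 \<le> s"
      have "((\<lambda>s. V (T s x)) has_real_derivative - (norm (T s x))\<^sup>2) (at_right s)"
        using V_right_derivative[OF orbit_right_derivative(2)[OF x \<open>0 \<le> s\<close>]]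
          lyapunov[OF orbit_right_derivative(1)[OF x \<open>0 \<le> s\<close>]]
        by (simp add: real_derivative_at_right_iff)
      from DERIV_add[OF this der_I[OF \<open>0 \<le> s\<close>]]
      show "(?f has_real_derivative 0) (at_right s)" by simp
    qed
    then show ?thesis by (simp add: T_0)
  qed
  then have "D \<subseteq> ?E" by blast
  moreover have "closed ?E"
  proof (intro closed_Collect_eq continuous_on_V continuous_on_T continuous_on_diff continuous_on_id
      continuous_on_const t)
    \<comment> \<open>Joint continuity of the semigroup makes the integral continuous in
      \<open>x\<close>.\<close>
    have "continuous_on (UNIV \<times> {0..t}) (\<lambda>(x, s). (norm (T s x))\<^sup>2)"
      unfolding split_beta by (intro continuous_intros continuous_on_T) auto
    from integral_continuous_on_param[of UNIV 0 t, OF this[folded box_real(2)]]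
    show "continuous_on UNIV (\<lambda>x. ?I x t)" by simp
  qed
  ultimately have "closure D \<subseteq> ?E" by (rule closure_minimal)
  then have "x \<in> ?E" using closure_D by blast
  then show ?thesis by simp
qed

text \<open>\<open>V\<close> does not increase along orbits and is equivalent to the squared norm.
  The bound is uniform in time and serves as the constant \<open>M\<close> of the existence and
  uniqueness results.\<close>

lemma norm_T_le:
  assumes "t \<ge> 0"
  shows "norm (T t x) \<le> sqrt (p / k) * norm x"
proof -
  have "0 \<le> integral {0..t} (\<lambda>s. (norm (T s x))\<^sup>2)"
    by (intro integral_nonneg integrable_continuous_real continuous_on_subset[OF continuous_on_norm_orbit]) auto
  then have "k * (norm (T t x))\<^sup>2 \<le> p * (norm x)\<^sup>2"
    using V_ge[of "T t x"] V_le[of x] V_orbit[OF assms, of x] by linarith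
  then have "(norm (T t x))\<^sup>2 \<le> p / k * (norm x)\<^sup>2"
    using k_pos by (simp add: field_simps)
  then have "sqrt ((norm (T t x))\<^sup>2) \<le> sqrt (p / k * (norm x)\<^sup>2)"
    by (rule real_sqrt_le_mono)
  then show ?thesis by (simp only: real_sqrt_mult real_sqrt_abs abs_norm_cancel)
qed

text \<open>Restarting at time \<open>t\<close> gives
  \<open>x (t + h) = T h y + h *\<^sub>R q h\<close>, where \<open>q h\<close> tends to
  \<open>g t\<close>. The quotient of \<open>T h y - y\<close> may diverge, but that of
  \<open>V (T h y)\<close> converges by \<open>V_orbit\<close>, and the cross term needs only that
  \<open>T h y\<close> tends to \<open>y\<close>.\<close>

lemma V_mild_right_derivative:
  assumes g: "continuous_on {0..} g"
    and x: "\<And>t. t \<ge> 0 \<Longrightarrow> x t = T t (x 0) + convolution g t"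
    and t: "t \<ge> 0"
  shows "((\<lambda>t. V (x t)) has_real_derivative (2 * inner (P (x t)) (g t) - (norm (x t))\<^sup>2)) (at_right t)"
proof -
  define y where "y = x t"
  define c where "c = convolution (\<lambda>s. g (t + s))"
  define q where "q h = c h /\<^sub>R h" for h
  have "continuous_on {0..} (\<lambda>s. g (t + s))"
    by (rule continuous_on_compose2[OF g]) (use t in \<open>auto intro!: continuous_intros\<close>)
  from convolution_divide_tendsto[OF this] have q: "(q \<longlongrightarrow> g t) (at_right 0)"
    by (simp add: q_def [abs_def] c_def)
  have step: "x (t + h) = T h y + h *\<^sub>R q h" if "h > 0" for h
  proof -
    interpret bounded_linear "T h" using that by (intro bounded_linear_T) simp
    have "T (t + h) (x 0) = T h (T t (x 0))"
      using T_add[of h t "x 0"] t that by (simp add: add.commute)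
    then show ?thesis
      using x[of "t + h"] x[of t] t that convolution_add[OF g t, of h]
      by (simp add: y_def q_def c_def add)
  qed
  have Vorb: "((\<lambda>h. (V (T h y) - V y) / h) \<longlongrightarrow> - (norm y)\<^sup>2) (at_right 0)"
  proof -
    have "((\<lambda>h. - (integral {0..h} (\<lambda>s. (norm (T s y))\<^sup>2) / h)) \<longlongrightarrow> - (norm y)\<^sup>2) (at_right 0)"
      using integral_right_derivative[OF continuous_on_norm_orbit, of 0 y]
      by (intro tendsto_minus) (simp add: real_derivative_at_right_iff T_0)
    moreover have "eventually (\<lambda>h. - (integral {0..h} (\<lambda>s. (norm (T s y))\<^sup>2) / h) = (V (T h y) - V y) / h) (at_right 0)"
      using eventually_at_right_less[of 0] by eventually_elim (simp add: V_orbit)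
    ultimately show ?thesis by (rule Lim_transform_eventually)
  qed
  have "((\<lambda>h. (V (T h y) - V y) / h + 2 * inner (P (T h y)) (q h) + inner (P (h *\<^sub>R q h)) (q h))
      \<longlongrightarrow> - (norm y)\<^sup>2 + 2 * inner (P y) (g t) + inner (P (0 *\<^sub>R g t)) (g t)) (at_right 0)"
    by (intro tendsto_add Vorb tendsto_mult tendsto_inner P.tendsto tendsto_scaleR q
        tendsto_const tendsto_ident_at tendsto_T_0)
  moreover have "eventually (\<lambda>h. (V (T h y) - V y) / h + 2 * inner (P (T h y)) (q h) + inner (P (h *\<^sub>R q h)) (q h)
      = (V (x (t + h)) - V (x t)) / h) (at_right 0)"
    using eventually_at_right_less[of 0]
  proof eventually_elim
    case (elim h)
    have "V (h *\<^sub>R q h) = h * inner (P (h *\<^sub>R q h)) (q h)" by (simp add: V_def)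
    then have "V (x (t + h)) - V (x t) = (V (T h y) - V y) + h * (2 * inner (P (T h y)) (q h) + inner (P (h *\<^sub>R q h)) (q h))"
      using step[OF elim] by (simp add: V_add distrib_left flip: y_def)
    then show ?case using elim by (simp add: add_divide_distrib)
  qed
  ultimately show ?thesis
    by (simp add: Lim_transform_eventually P.zero real_derivative_at_right_iff y_def)
qed

section \<open>Decay of the quadratic form and the resulting norm estimate\<close>

definition decay :: "real \<Rightarrow> real \<Rightarrow> real" where
  "decay r t = sqrt (((1 + p * r\<^sup>2 * exp (- (1 / (2 * p)) * t))\<^sup>2 - 1) / k)"

definition overshoot :: "real \<Rightarrow> real" where
  "overshoot s = sqrt ((exp (2 * s) - 1) / k)"

lemma decay_class_KL: "decay \<in> class_KL"
  using class_KL_decay[of k p "1 / (2 * p)"] k_pos p_pos by (simp add: decay_def[abs_def])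

lemma overshoot_class_K_inf: "overshoot \<in> class_K_inf"
  using class_K_inf_sqrt_exp[OF k_pos] by (simp add: overshoot_def[abs_def])

text \<open>With \<open>c = 1 / (2 * p)\<close> and \<open>S t\<close> the integral of \<open>w\<close>, the function
  \<open>exp (c * t) * ((1 + V (x t)) * exp (- S t) - 1)\<close> is nonincreasing.\<close>

lemma V_decay:
  assumes cx: "continuous_on {0..} x" and cw: "continuous_on {0..} w"
    and w: "\<And>t. t \<ge> 0 \<Longrightarrow> w t \<ge> 0"
    and der: "\<And>t. t \<ge> 0 \<Longrightarrow> ((\<lambda>t. V (x t)) has_real_derivative V' t) (at_right t)"
    and V': "\<And>t. t \<ge> 0 \<Longrightarrow> V' t \<le> - (1 / (2 * p)) * V (x t) + (1 + V (x t)) * w t"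
    and t: "t \<ge> 0"
  shows "1 + V (x t) \<le> exp (integral {0..t} w) * (1 + V (x 0) * exp (- (1 / (2 * p)) * t))"
proof -
  define c where "c = 1 / (2 * p)"
  have c: "c > 0" using p_pos by (simp add: c_def)
  define S where "S t = integral {0..t} w" for t
  define h where "h t = exp (c * t) * ((1 + V (x t)) * exp (- S t) - 1)" for t
  have S_nonneg: "S t \<ge> 0" if "t \<ge> 0" for t
    unfolding S_def
    by (intro integral_nonneg integrable_continuous_real continuous_on_subset[OF cw] w) auto
  have cS: "continuous_on {0..t} S"
    unfolding S_def
    by (intro indefinite_integral_continuous_1 integrable_continuous_real continuous_on_subset[OF cw]) auto
  have "h t \<le> h 0"
  proof (rule right_derivative_nonpos_imp_le[OF t])
    show "continuous_on {0..t} h"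
      unfolding h_def by (intro continuous_intros continuous_on_V cS continuous_on_subset[OF cx]) auto
    fix s :: real assume s: "0 \<le> s"
    let ?d = "exp (c * s) * (c * ((1 + V (x s)) * exp (- S s) - 1) + (V' s - (1 + V (x s)) * w s) * exp (- S s))"
    have dS: "(S has_real_derivative w s) (at_right s)"
      unfolding S_def by (rule integral_right_derivative[OF cw s])
    have "(h has_real_derivative ?d) (at_right s)"
      unfolding h_def by (auto intro!: derivative_eq_intros der[OF s] dS simp: algebra_simps)
    moreover have "?d \<le> 0"
    proof -
      \<comment> \<open>The assumption on \<open>V'\<close> cancels the terms with \<open>w\<close>
        and \<open>V\<close>; what remains is \<open>c * (exp (- S s) - 1)\<close>, nonpositive
        because \<open>S s \<ge> 0\<close>.\<close>
      have "(V' s - (1 + V (x s)) * w s) * exp (- S s) \<le> - c * V (x s) * exp (- S s)"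
        using V'[OF s] by (intro mult_right_mono) (auto simp: c_def)
      then have "c * ((1 + V (x s)) * exp (- S s) - 1) + (V' s - (1 + V (x s)) * w s) * exp (- S s)
          \<le> c * (exp (- S s) - 1)"
        by (simp add: algebra_simps)
      also have "\<dots> \<le> 0" using c S_nonneg[OF s] by (simp add: mult_le_0_iff)
      finally show ?thesis by (simp add: mult_le_0_iff)
    qed
    ultimately show "\<exists>d\<le>0. (h has_real_derivative d) (at_right s)" by blast
  qed
  also have "h 0 = V (x 0)" by (simp add: h_def S_def)
  finally have "exp (- c * t) * (exp (c * t) * ((1 + V (x t)) * exp (- S t) - 1)) \<le> exp (- c * t) * V (x 0)"
    unfolding h_def by (intro mult_left_mono) auto
  then have "(1 + V (x t)) * exp (- S t) \<le> 1 + V (x 0) * exp (- c * t)"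
    by (simp add: mult.commute flip: mult.assoc exp_add)
  then have "exp (S t) * ((1 + V (x t)) * exp (- S t)) \<le> exp (S t) * (1 + V (x 0) * exp (- c * t))"
    by (intro mult_left_mono) auto
  moreover have "exp (S t) * ((1 + V (x t)) * exp (- S t)) = 1 + V (x t)"
    by (simp add: exp_minus)
  ultimately show ?thesis by (simp only: S_def c_def)
qed

text \<open>The product bound has to become a sum. Since \<open>exp s\<close> and \<open>a\<close>
  are at least 1, their product is at most \<open>(exp s)\<^sup>2 + a\<^sup>2 - 1\<close>;
  subtracting 1 leaves two summands that vanish with the input and with the initial state, and
  subadditivity of the square root separates them.\<close>

lemma norm_le_decay_overshoot:
  assumes s: "s \<ge> 0" and V: "1 + V y \<le> exp s * (1 + V z * exp (- (1 / (2 * p)) * t))"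
  shows "norm y \<le> decay (norm z) t + overshoot s"
proof -
  define a where "a = 1 + p * (norm z)\<^sup>2 * exp (- (1 / (2 * p)) * t)"
  have a: "a \<ge> 1" using p_pos by (simp add: a_def)
  have "V z * exp (- (1 / (2 * p)) * t) \<le> p * (norm z)\<^sup>2 * exp (- (1 / (2 * p)) * t)"
    by (intro mult_right_mono V_le) auto
  then have "exp s * (1 + V z * exp (- (1 / (2 * p)) * t)) \<le> exp s * a"
    by (intro mult_left_mono) (auto simp: a_def)
  with V have "1 + V y \<le> exp s * a" by linarith
  also have "\<dots> \<le> ((exp s)\<^sup>2 + a\<^sup>2) / 2"
    using sum_squares_bound[of "exp s" a] by simp
  also have "\<dots> \<le> (exp s)\<^sup>2 + a\<^sup>2 - 1"
  proof -
    have "1\<^sup>2 \<le> (exp s)\<^sup>2" "1\<^sup>2 \<le> a\<^sup>2" using s a by (intro power_mono; simp)+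
    then show ?thesis by (simp add: field_simps)
  qed
  finally have "k * (norm y)\<^sup>2 \<le> (a\<^sup>2 - 1) + (exp (2 * s) - 1)"
    using V_ge[of y] by (simp add: power2_eq_square flip: exp_add)
  then have "(norm y)\<^sup>2 \<le> (a\<^sup>2 - 1) / k + (exp (2 * s) - 1) / k"
    using k_pos by (simp add: pos_le_divide_eq mult.commute flip: add_divide_distrib)
  then have "sqrt ((norm y)\<^sup>2) \<le> sqrt ((a\<^sup>2 - 1) / k + (exp (2 * s) - 1) / k)"
    by (rule real_sqrt_le_mono)
  also have "\<dots> \<le> sqrt ((a\<^sup>2 - 1) / k) + sqrt ((exp (2 * s) - 1) / k)"
    using k_pos s a by (intro sqrt_add_le_add_sqrt divide_nonneg_pos) (auto simp: one_le_power)
  finally show ?thesis by (simp add: decay_def overshoot_def a_def)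
qed

end

section \<open>Integral input-to-state stability\<close>

locale bilinear_control_system = lyapunov_semigroup T D A P k p
  for T :: "real \<Rightarrow> 'x::{real_inner, banach} \<Rightarrow> 'x" and D A P k p +
  fixes f :: "'x \<Rightarrow> 'u::banach \<Rightarrow> 'x" and b K :: real and \<xi> :: "real \<Rightarrow> real"
  assumes b_pos: "b > 0" and K_pos: "K > 0" and \<xi>: "\<xi> \<in> class_K"
    and f_growth: "norm (f x v) \<le> b * norm v + K * norm x * \<xi> (norm v)"
    and f_lipschitz: "lipschitz_on_bounded_sets f"
    and f_continuous: "continuous_on UNIV (f x)"
begin

text \<open>The constants come from \<open>dissipation\<close>: the quadratic term remains after
  half of \<open>(norm x)\<^sup>2\<close> has absorbed the cross term, and \<open>1 / k\<close>
  comes from \<open>(norm x)\<^sup>2 \<le> (1 + V x) / k\<close>.\<close>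

definition gain :: "real \<Rightarrow> real" where
  "gain r = 2 * p\<^sup>2 * b\<^sup>2 * r\<^sup>2 + 2 * p * K / k * \<xi> r"

lemma gain_class_K: "gain \<in> class_K"
  using class_K_add_power2[of "2 * p\<^sup>2 * b\<^sup>2" "2 * p * K / k" \<xi>] p_pos K_pos k_pos \<xi>
  by (simp add: gain_def[abs_def])

lemma \<xi>_nonneg: "r \<ge> 0 \<Longrightarrow> \<xi> r \<ge> 0"
  using \<xi> by (cases "r = 0") (auto simp: class_K_def class_P_def less_le)

lemma gain_nonneg: "r \<ge> 0 \<Longrightarrow> gain r \<ge> 0"
  using \<xi>_nonneg[of r] p_pos K_pos k_pos by (simp add: gain_def)

lemma continuous_on_gain_norm:
  assumes "continuous_on {0..} u"
  shows "continuous_on {0..} (\<lambda>s. gain (norm (u s)))"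
proof (rule continuous_on_compose2[of "{0..}" gain])
  show "continuous_on {0..} gain"
    using gain_class_K by (simp add: class_K_def class_P_def)
qed (auto intro!: continuous_intros assms)

text \<open>Stated for a vector \<open>g\<close> obeying the growth bound, so that it applies to
  truncated nonlinearities as well as to \<open>f\<close>.\<close>

lemma dissipation:
  assumes g: "norm g \<le> b * norm v + K * norm x * \<xi> (norm v)"
  shows "2 * inner (P x) g - (norm x)\<^sup>2 \<le> - (norm x)\<^sup>2 / 2 + (1 + V x) * gain (norm v)"
proof -
  have \<xi>n: "\<xi> (norm v) \<ge> 0" by (rule \<xi>_nonneg) simp
  have "inner (P x) g \<le> norm (P x) * norm g" by (rule norm_cauchy_schwarz)
  also have "\<dots> \<le> (p * norm x) * (b * norm v + K * norm x * \<xi> (norm v))"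
    using p_pos by (intro mult_mono norm_P_le g) auto
  finally have "2 * inner (P x) g \<le> 2 * norm x * (p * b * norm v) + 2 * p * K * \<xi> (norm v) * (norm x)\<^sup>2"
    by (simp add: algebra_simps power2_eq_square)
  moreover have "2 * norm x * (p * b * norm v) \<le> (norm x)\<^sup>2 / 2 + 2 * p\<^sup>2 * b\<^sup>2 * (norm v)\<^sup>2"
    using zero_le_power2[of "norm x / 2 - p * b * norm v"]
    by (simp add: power2_diff power_divide power_mult_distrib field_simps)
  moreover have "2 * p\<^sup>2 * b\<^sup>2 * (norm v)\<^sup>2 \<le> (1 + V x) * (2 * p\<^sup>2 * b\<^sup>2 * (norm v)\<^sup>2)"
    using V_nonneg[of x] mult_right_mono[of 1 "1 + V x" "2 * p\<^sup>2 * b\<^sup>2 * (norm v)\<^sup>2"] by simp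
  moreover have "2 * p * K * \<xi> (norm v) * (norm x)\<^sup>2 \<le> (1 + V x) * (2 * p * K / k * \<xi> (norm v))"
  proof -
    have "(norm x)\<^sup>2 \<le> (1 + V x) / k"
      using V_ge[of x] k_pos by (simp add: pos_le_divide_eq mult.commute)
    then have "2 * p * K * \<xi> (norm v) * (norm x)\<^sup>2 \<le> 2 * p * K * \<xi> (norm v) * ((1 + V x) / k)"
      using p_pos K_pos \<xi>n by (intro mult_left_mono) auto
    then show ?thesis by (simp add: mult_ac)
  qed
  ultimately show ?thesis by (simp add: gain_def distrib_left)
qed

text \<open>The bound involves neither a Lipschitz constant nor a truncation radius of the forcing
  term, so a radius can be chosen afterwards.\<close>

lemma mild_bound:
  assumes u: "continuous_on {0..} u" and g: "continuous_on {0..} g"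
    and x: "\<And>t. t \<ge> 0 \<Longrightarrow> x t = T t (x 0) + convolution g t"
    and cx: "continuous_on {0..} x"
    and growth: "\<And>t. t \<ge> 0 \<Longrightarrow> norm (g t) \<le> b * norm (u t) + K * norm (x t) * \<xi> (norm (u t))"
    and t: "t \<ge> 0"
  shows "norm (x t) \<le> decay (norm (x 0)) t + overshoot (integral {0..t} (\<lambda>s. gain (norm (u s))))"
proof (rule norm_le_decay_overshoot)
  show "0 \<le> integral {0..t} (\<lambda>s. gain (norm (u s)))"
    by (intro integral_nonneg integrable_continuous_real
        continuous_on_subset[OF continuous_on_gain_norm[OF u]] gain_nonneg) auto
  show "1 + V (x t) \<le> exp (integral {0..t} (\<lambda>s. gain (norm (u s)))) * (1 + V (x 0) * exp (- (1 / (2 * p)) * t))"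
  proof (rule V_decay[OF cx continuous_on_gain_norm[OF u] _ V_mild_right_derivative[OF g x] _ t])
    fix s :: real assume s: "s \<ge> 0"
    \<comment> \<open>The remaining half of the decay, compared with \<open>V\<close>, gives the
      rate \<open>1 / (2 * p)\<close>.\<close>
    have "- (norm (x s))\<^sup>2 / 2 \<le> - (1 / (2 * p)) * V (x s)"
      using V_le[of "x s"] p_pos by (simp add: field_simps)
    with dissipation[OF growth[OF s]]
    show "2 * inner (P (x s)) (g s) - (norm (x s))\<^sup>2 \<le>
        - (1 / (2 * p)) * V (x s) + (1 + V (x s)) * gain (norm (u s))"
      by linarith
  qed (auto intro: gain_nonneg)
qed

text \<open>The Lipschitz constant in the state is uniform over inputs, so the state may be frozen
  at \<open>x s\<close> while the input still moves; continuity in the input does the rest.\<close>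

lemma continuous_on_f:
  assumes "continuous_on S x" "continuous_on S v"
  shows "continuous_on S (\<lambda>s. f (x s) (v s))"
  unfolding continuous_on_def
proof
  fix s assume s: "s \<in> S"
  have x: "(x \<longlongrightarrow> x s) (at s within S)" and v: "(v \<longlongrightarrow> v s) (at s within S)"
    using assms s by (auto simp: continuous_on_def)
  define w where "w = norm (x s) + 1"
  have "w > 0" by (simp add: w_def add_nonneg_pos)
  then obtain L where L: "\<And>x y v. norm x \<le> w \<Longrightarrow> norm y \<le> w \<Longrightarrow> norm (f y v - f x v) \<le> L * norm (y - x)"
    using f_lipschitz unfolding lipschitz_on_bounded_sets_def by meson
  have "((\<lambda>r. norm (x r - x s)) \<longlongrightarrow> 0) (at s within S)"
    using x by (simp add: LIM_zero_iff tendsto_norm_zero)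
  then have lim: "((\<lambda>r. L * norm (x r - x s)) \<longlongrightarrow> 0) (at s within S)"
    by (rule tendsto_mult_right_zero)
  have "eventually (\<lambda>r. norm (x r) < w) (at s within S)"
    by (rule order_tendstoD(2)[OF tendsto_norm[OF x]]) (simp add: w_def)
  then have "eventually (\<lambda>r. norm (f (x r) (v r) - f (x s) (v r)) \<le> L * norm (x r - x s)) (at s within S)"
    by eventually_elim (rule L; simp add: w_def)
  from Lim_null_comparison[OF this lim]
  have "((\<lambda>r. f (x r) (v r) - f (x s) (v r)) \<longlongrightarrow> 0) (at s within S)" .
  moreover have "((\<lambda>r. f (x s) (v r)) \<longlongrightarrow> f (x s) (v s)) (at s within S)"
    using continuous_on_tendsto_compose[OF f_continuous v] by simp
  ultimately have "((\<lambda>r. (f (x r) (v r) - f (x s) (v r)) + f (x s) (v r)) \<longlongrightarrow> 0 + f (x s) (v s)) (at s within S)"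
    by (rule tendsto_add)
  then show "((\<lambda>r. f (x r) (v r)) \<longlongrightarrow> f (x s) (v s)) (at s within S)" by simp
qed

lemma sqrt_p_div_k_pos: "sqrt (p / k) > 0"
  using p_pos k_pos by simp

text \<open>The nonlinearity is made globally Lipschitz by composing it with a radial retraction; this
  preserves the growth bound, so for a large enough radius the a priori bound shows that the
  modification is never felt up to time \<open>\<tau>\<close>.\<close>

lemma mild_solution_exists:
  assumes u: "u \<in> admissible_inputs" and \<tau>: "\<tau> \<ge> 0"
  shows "\<exists>x. mild_solution T f u {0..\<tau>} x \<and> x 0 = x0"
proof -
  have cu: "continuous_on {0..} u" and "bounded (u ` {0..})"
    using u by (auto simp: admissible_inputs_def)
  then obtain m where m: "\<And>s. s \<ge> 0 \<Longrightarrow> norm (u s) \<le> m"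
    by (auto simp: bounded_iff)
  let ?I = "\<lambda>t. integral {0..t} (\<lambda>s. gain (norm (u s)))"
  have cg: "continuous_on S (\<lambda>s. gain (norm (u s)))" if "S \<subseteq> {0..}" for S
    by (rule continuous_on_subset[OF continuous_on_gain_norm[OF cu] that])
  have nn: "decay r t \<ge> 0" "overshoot r \<ge> 0" if "r \<ge> 0" "t \<ge> 0" for r t
    using decay_class_KL overshoot_class_K_inf that
    by (cases "r = 0"; force simp: class_KL_def class_K_inf_def class_K_def class_P_def less_le)+
  have I_nonneg: "?I t \<ge> 0" if "t \<ge> 0" for t
    by (intro integral_nonneg integrable_continuous_real cg gain_nonneg) auto
  \<comment> \<open>The largest value of the a priori bound on \<open>{0..\<tau>}\<close>: decay at
    time 0, input integrated over the whole interval. The summand 1 makes the radius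
    positive.\<close>
  define R where "R = decay (norm x0) 0 + overshoot (?I \<tau>) + 1"
  have R: "R > 0"
    using nn(1)[of "norm x0" 0] nn(2)[OF I_nonneg[OF \<tau>] order_refl] by (simp add: R_def)
  obtain L where L: "L > 0" "\<And>x y v. norm x \<le> R \<Longrightarrow> norm y \<le> R \<Longrightarrow> norm (f y v - f x v) \<le> L * norm (y - x)"
    using f_lipschitz R unfolding lipschitz_on_bounded_sets_def by meson
  define F where "F s x = f (radial R x) (u s)" for s x
  have F_growth: "norm (F s x) \<le> b * norm (u s) + K * norm x * \<xi> (norm (u s))" for s x
  proof -
    have "K * norm (radial R x) * \<xi> (norm (u s)) \<le> K * norm x * \<xi> (norm (u s))"
      using K_pos norm_radial_le(2)[OF R, of x] \<xi>_nonneg[of "norm (u s)"]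
      by (intro mult_right_mono mult_left_mono) auto
    with f_growth[of "radial R x" "u s"] show ?thesis unfolding F_def by linarith
  qed
  have cF: "continuous_on ({0..} \<times> UNIV) (\<lambda>(s, x). F s x)"
    unfolding F_def split_beta
    by (intro continuous_on_f continuous_on_compose2[OF continuous_on_radial[OF R, of UNIV]]
        continuous_on_compose2[OF cu] continuous_intros) auto
  have F_lip: "norm (F s x - F s y) \<le> L * 2 * norm (x - y)" for s x y
  proof -
    have "norm (F s x - F s y) \<le> L * norm (radial R x - radial R y)"
      unfolding F_def by (intro L norm_radial_le R)
    also have "\<dots> \<le> L * (2 * norm (x - y))"
      using L(1) R by (intro mult_left_mono radial_lipschitz) auto
    finally show ?thesis by simp
  qed
  have F_0: "norm (F s 0) \<le> b * m" if "s \<ge> 0" for s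
  proof -
    have "b * norm (u s) \<le> b * m" using m[OF that] b_pos by (intro mult_left_mono) auto
    then show ?thesis using F_growth[of s 0] by simp
  qed
  have L2: "L * 2 > 0" using L(1) by simp
  obtain x where cx: "continuous_on {0..} x"
    and x: "\<And>t. t \<ge> 0 \<Longrightarrow> x t = T t x0 + convolution (\<lambda>s. F s (x s)) t"
    by (rule mild_existence[OF sqrt_p_div_k_pos norm_T_le cF L2 F_lip F_0, where ?x0.0 = x0])
      (assumption | rule that)+
  have x0: "x 0 = x0" using x[of 0] by (simp add: T_0 convolution_def)
  have g: "continuous_on {0..} (\<lambda>s. F s (x s))"
    unfolding F_def
    by (intro continuous_on_f continuous_on_compose2[OF continuous_on_radial[OF R, of UNIV] cx] cu) auto
  have bound: "norm (x t) \<le> R" if t: "t \<in> {0..\<tau>}" for t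
  proof -
    have "norm (x t) \<le> decay (norm (x 0)) t + overshoot (?I t)"
      using t by (intro mild_bound[OF cu g]) (auto simp: x0 x cx F_growth)
    moreover have "decay (norm x0) t \<le> decay (norm x0) 0"
      using t k_pos p_pos unfolding decay_def
      by (intro real_sqrt_le_mono divide_right_mono diff_right_mono power_mono add_left_mono mult_left_mono)
        (auto intro: add_nonneg_nonneg)
    moreover have "overshoot (?I t) \<le> overshoot (?I \<tau>)"
    proof -
      have "?I t \<le> ?I \<tau>"
        using t by (intro integral_subset_le integrable_continuous_real cg) (auto intro: gain_nonneg)
      then show ?thesis
        unfolding overshoot_def using k_pos by (intro real_sqrt_le_mono divide_right_mono) auto
    qed
    ultimately show ?thesis by (simp add: R_def x0)
  qed
  have F_eq: "F s (x s) = f (x s) (u s)" if "s \<in> {0..\<tau>}" for s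
    using bound[OF that] R by (simp add: F_def radial_id)
  have "mild_solution T f u {0..\<tau>} x"
    unfolding mild_solution_def
  proof (intro conjI ballI)
    show "continuous_on {0..\<tau>} x" by (rule continuous_on_subset[OF cx]) auto
    fix t assume t: "t \<in> {0..\<tau>}"
    have eq: "T (t - s) (F s (x s)) = T (t - s) (f (x s) (u s))" if "s \<in> {0..t}" for s
      using F_eq[of s] that t by simp
    have "(\<lambda>s. T (t - s) (F s (x s))) integrable_on {0..t}"
      by (intro integrable_continuous_real continuous_on_convolution_integrand g)
    then show "(\<lambda>s. T (t - s) (f (x s) (u s))) integrable_on {0..t}"
      by (rule integrable_eq) (rule eq)
    have "x t = T t (x 0) + integral {0..t} (\<lambda>s. T (t - s) (F s (x s)))"
      using x[of t] t by (simp only: x0 convolution_def atLeastAtMost_iff)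
    also have "integral {0..t} (\<lambda>s. T (t - s) (F s (x s))) = integral {0..t} (\<lambda>s. T (t - s) (f (x s) (u s)))"
      by (intro integral_cong eq)
    finally show "x t = T t (x 0) + integral {0..t} (\<lambda>s. T (t - s) (f (x s) (u s)))" .
  qed
  with x0 show ?thesis by blast
qed

lemma phi_global:
  fixes z :: 'x
  assumes u: "u \<in> admissible_inputs"
  defines "X \<equiv> \<lambda>t. phi T f t z u"
  shows "mild_solution T f u {0..} X" "X 0 = z" "continuous_on {0..} X"
    "continuous_on {0..} (\<lambda>s. f (X s) (u s))"
    "t \<ge> 0 \<Longrightarrow> X t = T t (X 0) + convolution (\<lambda>s. f (X s) (u s)) t"
proof -
  show X: "mild_solution T f u {0..} X" and "X 0 = z"
    unfolding X_def
    by (rule mild_solution_phi[OF sqrt_p_div_k_pos norm_T_le bounded_linear_T f_lipschitz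
          mild_solution_exists[OF u]]; assumption)+
  show "continuous_on {0..} X" by (rule mild_solutionD(1)[OF X])
  then show "continuous_on {0..} (\<lambda>s. f (X s) (u s))"
    using u by (intro continuous_on_f) (auto simp: admissible_inputs_def)
  show "X t = T t (X 0) + convolution (\<lambda>s. f (X s) (u s)) t" if "t \<ge> 0"
    unfolding convolution_def by (rule mild_solutionD(3)[OF X]) (use that in simp)
qed

section \<open>The stability estimate and the dissipation of \<open>ln (1 + V)\<close>\<close>

theorem integral_input_to_state_stable: "iISS T f"
proof -
  have "norm (phi T f t x0 u) \<le> decay (norm x0) t + overshoot (integral {0..t} (\<lambda>s. gain (norm (u s))))"
    if u: "u \<in> admissible_inputs" and t: "t \<ge> 0" for x0 u t
  proof -
    note X = phi_global[OF u, where z = x0]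
    have cu: "continuous_on {0..} u" using u by (simp add: admissible_inputs_def)
    show ?thesis
      using mild_bound[OF cu X(4) X(5) X(3) f_growth t] by (simp only: X(2))
  qed
  then show ?thesis
    unfolding iISS_def
    using phi_global(1,2) decay_class_KL gain_class_K overshoot_class_K_inf by meson
qed

text \<open>\<open>V\<close> has a right derivative along the solution, so the upper limit is a
  limit, namely \<open>d / (1 + V x)\<close>; the division removes the factor \<open>1 + V x\<close>
  from the gain in \<open>dissipation\<close>.\<close>

lemma lie_derivative_ln_V_le:
  assumes u: "u \<in> admissible_inputs"
  shows "lie_derivative T f (\<lambda>x. ln (1 + V x)) u x
    \<le> ereal (- ((norm x)\<^sup>2 / (2 * (1 + p * (norm x)\<^sup>2))) + gain (norm (u 0)))"
proof -
  define X where "X t = phi T f t x u" for t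
  note X = phi_global[OF u, where z = x, folded X_def]
  define d where "d = 2 * inner (P x) (f x (u 0)) - (norm x)\<^sup>2"
  have pos: "1 + V y > 0" for y using V_nonneg[of y] by linarith
  have "((\<lambda>t. V (X t)) has_real_derivative d) (at_right 0)"
    using V_mild_right_derivative[OF X(4) X(5) order_refl] by (simp only: X(2) d_def)
  then have "((\<lambda>t. ln (1 + V (X t))) has_real_derivative d / (1 + V x)) (at_right 0)"
    using pos by (auto intro!: derivative_eq_intros simp: X(2) field_simps)
  then have "((\<lambda>h. (ln (1 + V (X h)) - ln (1 + V x)) / h) \<longlongrightarrow> d / (1 + V x)) (at_right 0)"
    by (simp only: real_derivative_at_right_iff add_0_left X(2))
  then have "lie_derivative T f (\<lambda>x. ln (1 + V x)) u x = ereal (d / (1 + V x))"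
    unfolding lie_derivative_def X_def by (intro lim_imp_Limsup) (auto intro: tendsto_ereal)
  also have "d / (1 + V x) \<le> - ((norm x)\<^sup>2 / (2 * (1 + p * (norm x)\<^sup>2))) + gain (norm (u 0))"
  proof -
    have "d / (1 + V x) \<le> (- (norm x)\<^sup>2 / 2 + (1 + V x) * gain (norm (u 0))) / (1 + V x)"
      unfolding d_def using pos[of x] by (intro divide_right_mono dissipation f_growth) auto
    also have "\<dots> = - ((norm x)\<^sup>2 / (2 * (1 + V x))) + gain (norm (u 0))"
      using pos[of x] by (simp add: add_divide_distrib diff_divide_distrib distrib_left)
    finally have "d / (1 + V x) \<le> - ((norm x)\<^sup>2 / (2 * (1 + V x))) + gain (norm (u 0))" .
    \<comment> \<open>The rate has to depend on the norm alone, so \<open>V x\<close> is replaced by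
      its upper bound.\<close>
    moreover have "(norm x)\<^sup>2 / (2 * (1 + p * (norm x)\<^sup>2)) \<le> (norm x)\<^sup>2 / (2 * (1 + V x))"
      using V_le[of x] pos[of x] by (intro divide_left_mono mult_pos_pos) (auto intro: order_less_le_trans)
    ultimately show ?thesis by linarith
  qed
  finally show ?thesis by simp
qed

text \<open>The set \<open>S\<close> is arbitrary so that one statement covers both the whole space
  and \<open>D\<close>.\<close>

theorem ln_V_iISS_lyapunov: "iISS_lyapunov_on S T f (\<lambda>x. ln (1 + V x))"
proof -
  have pos: "1 + V y > 0" for y using V_nonneg[of y] by linarith
  have "1 + V y \<noteq> 0" for y using pos[of y] by simp
  then have "continuous_on S (\<lambda>x. ln (1 + V x))"
    by (intro continuous_intros continuous_on_V ballI)
  moreover have "0 \<le> ln (1 + V x)" for x using V_nonneg[of x] by simp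
  moreover have "ln (1 + k * (norm x)\<^sup>2) \<le> ln (1 + V x)" for x
  proof (rule ln_mono)
    show "0 < 1 + k * (norm x)\<^sup>2" using k_pos by (intro add_pos_nonneg) auto
  qed (simp add: V_ge)
  moreover have "ln (1 + V x) \<le> ln (1 + p * (norm x)\<^sup>2)" for x
    by (rule ln_mono) (use V_le pos in auto)
  ultimately show ?thesis
    unfolding iISS_lyapunov_on_def
    by (intro conjI ballI bexI[OF _ gain_class_K] bexI[OF _ class_P_rational[OF p_pos]]
        bexI[where P = "\<lambda>\<psi>. \<exists>\<psi>'\<in>class_K_inf. _ \<psi> \<psi>'", OF _ class_K_inf_ln[OF k_pos]]
        bexI[OF _ class_K_inf_ln[OF p_pos]] lie_derivative_ln_V_le)
qed

end

theorem theorem4: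
  fixes scaleX :: "'k::real_or_complex \<Rightarrow> 'x::{real_inner, banach} \<Rightarrow> 'x"
    and ip :: "'x \<Rightarrow> 'x \<Rightarrow> 'k"
    and scaleU :: "'k \<Rightarrow> 'u::banach \<Rightarrow> 'u"
    and D :: "'x set" and A :: "'x \<Rightarrow> 'x" and T :: "real \<Rightarrow> 'x \<Rightarrow> 'x"
    and B :: "'u \<Rightarrow> 'x" and C :: "'x \<Rightarrow> 'u \<Rightarrow> 'x" and f :: "'x \<Rightarrow> 'u \<Rightarrow> 'x"
    and P :: "'x \<Rightarrow> 'x" and W :: "'x \<Rightarrow> real"
    and K :: real and \<xi> :: "real \<Rightarrow> real"
  assumes X: "hilbert_over scaleX ip"
    and U: "banach_over scaleU"
    and A: "generates scaleX D A T"
    and B: "bounded_op scaleU scaleX B"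
    and C: "K > 0" "\<xi> \<in> class_K"
      "\<And>x u. norm (C x u) \<le> K * norm x * \<xi> (norm u)"
    and f: "\<And>x u. f x u = B u + C x u"
    and f_lipschitz: "lipschitz_on_bounded_sets f"
    and f_continuous: "\<And>x. continuous_on UNIV (f x)"
    and P: "bounded_op scaleX scaleX P" "coercive_op ip P"
    and lyapunov_eq: "\<And>x. x \<in> D \<Longrightarrow> ip (A x) (P x) + ip (P x) (A x) = - of_real ((norm x)\<^sup>2)"
    and W: "\<And>x. W x = ln (1 + re_part (ip (P x) x))"
  shows "(analytic_semigroup scaleX T \<longrightarrow> iISS T f \<and> iISS_lyapunov_on UNIV T f W) \<and>
    ((\<forall>x0\<in>D. \<forall>u\<in>admissible_inputs. \<forall>\<tau>\<ge>0. \<forall>x.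
        mild_solution T f u {0..\<tau>} x \<and> x 0 = x0 \<longrightarrow> (\<forall>t\<in>{0..\<tau>}. x t \<in> D)) \<longrightarrow>
      iISS T f \<and> iISS_lyapunov_on D T f W)"
proof -
  interpret hilbert_over scaleX ip by (rule X)
  have sg: "C0_semigroup scaleX T"
    and D: "D = {x. \<exists>y. ((\<lambda>h. (1 / h) *\<^sub>R (T h x - x)) \<longlongrightarrow> y) (at_right 0)}"
    and A': "\<And>x. x \<in> D \<Longrightarrow> ((\<lambda>h. (1 / h) *\<^sub>R (T h x - x)) \<longlongrightarrow> A x) (at_right 0)"
    using A unfolding generates_def by blast+
  have blP: "bounded_linear P" and blB: "bounded_linear B"
    using P(1) B by (auto simp: bounded_op_def)
  obtain p where p: "p > 0" "\<And>x. norm (P x) \<le> p * norm x"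
    using bounded_linear.pos_bounded[OF blP] by (auto simp: mult.commute)
  obtain b where b: "b > 0" "\<And>v. norm (B v) \<le> b * norm v"
    using bounded_linear.pos_bounded[OF blB] by (auto simp: mult.commute)
  obtain k where k: "k > 0" "\<And>x. k * (norm x)\<^sup>2 \<le> inner (P x) x"
    using P(2) by (auto simp: coercive_op_def re_part_ip)
  interpret sys: bilinear_control_system T D A P k p f b K \<xi>
  proof (intro bilinear_control_system.intro bilinear_control_system_axioms.intro
      lyapunov_semigroup.intro lyapunov_semigroup_axioms.intro semigroup_generator.intro
      semigroup_generator_axioms.intro strongly_continuous_semigroup.intro)
    show "bounded_linear (T t)" if "t \<ge> 0" for t
      using sg that unfolding C0_semigroup_def bounded_op_def by blast
    show "T 0 x = x" for x using sg unfolding C0_semigroup_def by blast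
    show "T (s + t) x = T s (T t x)" if "s \<ge> 0" "t \<ge> 0" for s t x
      using sg that unfolding C0_semigroup_def by blast
    show "((\<lambda>t. T t x) \<longlongrightarrow> x) (at_right 0)" for x
      using sg unfolding C0_semigroup_def by blast
    show "D = {x. \<exists>y. ((\<lambda>h. (1 / h) *\<^sub>R (T h x - x)) \<longlongrightarrow> y) (at_right 0)}" by (rule D)
    show "((\<lambda>h. (1 / h) *\<^sub>R (T h x - x)) \<longlongrightarrow> A x) (at_right 0)" if "x \<in> D" for x
      by (rule A'[OF that])
    show "bounded_linear P" by (rule blP)
    have "ip (P x) y = ip x (P y)" for x y
      using P(2) by (simp add: coercive_op_def positive_op_def self_adjoint_op_def)
    then have "re_part (ip (P x) y) = re_part (ip x (P y))" for x y by simp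
    then show "inner (P x) y = inner x (P y)" for x y by (simp add: re_part_ip)
    show "2 * inner (P x) (A x) = - (norm x)\<^sup>2" if "x \<in> D" for x
    proof -
      \<comment> \<open>The two summands are complex conjugates, so the real part of the equation is
        twice that of either.\<close>
      have "re_part (ip (A x) (P x) + ip (P x) (A x)) = - (norm x)\<^sup>2"
        using lyapunov_eq[OF that] to_complex_of_real[of "- (norm x)\<^sup>2", where 'k = 'k]
        by (simp add: re_part_def)
      then have "re_part (ip (A x) (P x)) + re_part (ip (P x) (A x)) = - (norm x)\<^sup>2"
        by (simp add: re_part_def to_complex_add)
      then show ?thesis by (simp add: re_part_ip inner_commute)
    qed
    show "norm (f x v) \<le> b * norm v + K * norm x * \<xi> (norm v)" for x v
      unfolding f using norm_triangle_ineq[of "B v" "C x v"] b(2)[of v] C(3)[of x v] by linarith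
  qed (use p k b C f_lipschitz f_continuous in auto)
  have "W = (\<lambda>x. ln (1 + sys.V x))"
    by (simp add: fun_eq_iff W re_part_ip sys.V_def)
  then show ?thesis
    using sys.integral_input_to_state_stable sys.ln_V_iISS_lyapunov by simp
qed

end
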